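(* Let $G$ be a graph that contains one of $C_3$, $C_4$, $P_4$, $Y$ as a subgraph. Then $\mathbf{Gra}/G$ is algebraically universal.
   Context: Graphs are undirected and loopless; homomorphisms preserve edges; subgraphs need not be induced. $C_n$ is the cycle on $n$ vertices, $P_4$ the path with four edges, and $Y$ the graph on vertices $\{0,1,2,3\}$ with edges $\{0,1\},\{1,2\},\{1,3\}$. The slice category $\mathbf{Gra}/G$ has as objects pairs $(A,f)$ with $f:A\to G$ a homomorphism, and morphisms $(A,f)\to(B,g)$ the homomorphisms $\psi:A\to B$ with $f=g\circ\psi$. A category is algebraic if it is isomorphic to a full subcategory of the category of universal algebras of some type; a category $\mathfrak{C}$ is algebraically universal if every algebraic category fully embeds into $\mathfrak{C}$. *)

theory Defs
  imports "HOL-Library.FuncSet" "HOL-Library.Equipollence"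
begin

section \<open>Categories\<close>

text \<open>
  A category is given by its objects and a family of hom-sets. Distinct hom-sets may overlap, so
  composition (and the action of a functor on morphisms) takes the objects involved as arguments:
  \<open>Comp C a b c g f\<close> is the composite of \<open>f : a \<rightarrow> b\<close> and \<open>g : b \<rightarrow> c\<close>.
\<close>

record ('o, 'm) category =
  Obj :: "'o set"
  Hom :: "'o \<Rightarrow> 'o \<Rightarrow> 'm set"
  Ident :: "'o \<Rightarrow> 'm"
  Comp :: "'o \<Rightarrow> 'o \<Rightarrow> 'o \<Rightarrow> 'm \<Rightarrow> 'm \<Rightarrow> 'm"

definition is_category :: "('o, 'm) category \<Rightarrow> bool" where
  "is_category C \<longleftrightarrow>
     (\<forall>a\<in>Obj C. Ident C a \<in> Hom C a a) \<and>
     (\<forall>a\<in>Obj C. \<forall>b\<in>Obj C. \<forall>c\<in>Obj C. \<forall>f\<in>Hom C a b. \<forall>g\<in>Hom C b c.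
        Comp C a b c g f \<in> Hom C a c) \<and>
     (\<forall>a\<in>Obj C. \<forall>b\<in>Obj C. \<forall>f\<in>Hom C a b.
        Comp C a a b f (Ident C a) = f \<and> Comp C a b b (Ident C b) f = f) \<and>
     (\<forall>a\<in>Obj C. \<forall>b\<in>Obj C. \<forall>c\<in>Obj C. \<forall>d\<in>Obj C.
        \<forall>f\<in>Hom C a b. \<forall>g\<in>Hom C b c. \<forall>h\<in>Hom C c d.
        Comp C a c d h (Comp C a b c g f) = Comp C a b d (Comp C b c d h g) f)"

definition is_functor ::
  "('o, 'm) category \<Rightarrow> ('p, 'n) category \<Rightarrow> ('o \<Rightarrow> 'p) \<Rightarrow> ('o \<Rightarrow> 'o \<Rightarrow> 'm \<Rightarrow> 'n) \<Rightarrow> bool" where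
  "is_functor C D Fo Fm \<longleftrightarrow>
     (\<forall>a\<in>Obj C. Fo a \<in> Obj D) \<and>
     (\<forall>a\<in>Obj C. \<forall>b\<in>Obj C. \<forall>f\<in>Hom C a b. Fm a b f \<in> Hom D (Fo a) (Fo b)) \<and>
     (\<forall>a\<in>Obj C. Fm a a (Ident C a) = Ident D (Fo a)) \<and>
     (\<forall>a\<in>Obj C. \<forall>b\<in>Obj C. \<forall>c\<in>Obj C. \<forall>f\<in>Hom C a b. \<forall>g\<in>Hom C b c.
        Fm a c (Comp C a b c g f) = Comp D (Fo a) (Fo b) (Fo c) (Fm b c g) (Fm a b f))"

definition full_subcategory :: "('o, 'm) category \<Rightarrow> 'o set \<Rightarrow> ('o, 'm) category" where
  "full_subcategory C S = C\<lparr>Obj := Obj C \<inter> S\<rparr>"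

definition isomorphic_categories :: "('o, 'm) category \<Rightarrow> ('p, 'n) category \<Rightarrow> bool" where
  "isomorphic_categories C D \<longleftrightarrow>
     (\<exists>Fo Fm Go Gm. is_functor C D Fo Fm \<and> is_functor D C Go Gm \<and>
        (\<forall>a\<in>Obj C. Go (Fo a) = a) \<and>
        (\<forall>x\<in>Obj D. Fo (Go x) = x) \<and>
        (\<forall>a\<in>Obj C. \<forall>b\<in>Obj C. \<forall>f\<in>Hom C a b. Gm (Fo a) (Fo b) (Fm a b f) = f) \<and>
        (\<forall>x\<in>Obj D. \<forall>y\<in>Obj D. \<forall>g\<in>Hom D x y. Fm (Go x) (Go y) (Gm x y g) = g))"

definition full_embedding ::
  "('o, 'm) category \<Rightarrow> ('p, 'n) category \<Rightarrow> ('o \<Rightarrow> 'p) \<Rightarrow> ('o \<Rightarrow> 'o \<Rightarrow> 'm \<Rightarrow> 'n) \<Rightarrow> bool" where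
  "full_embedding C D Fo Fm \<longleftrightarrow>
     is_functor C D Fo Fm \<and>
     inj_on Fo (Obj C) \<and>
     (\<forall>a\<in>Obj C. \<forall>b\<in>Obj C. inj_on (Fm a b) (Hom C a b)) \<and>
     (\<forall>a\<in>Obj C. \<forall>b\<in>Obj C. Fm a b ` Hom C a b = Hom D (Fo a) (Fo b))"

definition fully_embeds :: "('o, 'm) category \<Rightarrow> ('p, 'n) category \<Rightarrow> bool" where
  "fully_embeds C D \<longleftrightarrow> (\<exists>Fo Fm. full_embedding C D Fo Fm)"

definition slice_category :: "('o, 'm) category \<Rightarrow> 'o \<Rightarrow> ('o \<times> 'm, 'm) category" where
  "slice_category C G =
     \<lparr> Obj = {(A, f). A \<in> Obj C \<and> f \<in> Hom C A G},
       Hom = (\<lambda>(A, f) (B, g). {\<psi> \<in> Hom C A B. f = Comp C A B G g \<psi>}),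
       Ident = (\<lambda>(A, f). Ident C A),
       Comp = (\<lambda>(A, f) (B, g) (D, h). Comp C A B D) \<rparr>"


section \<open>Universes\<close>

text \<open>
  A family \<open>U\<close> of subsets of a type plays the role of the class of all sets: every category of
  structured sets below has precisely the structures with underlying set in \<open>U\<close> as objects.
  The two main instances are all subsets of an infinite type, and all subsets of cardinality less
  than \<open>\<kappa>\<close> of a type of inaccessible cardinality \<open>\<kappa>\<close> (a Grothendieck universe, up to bijection).
\<close>

definition set_universe :: "'u set set \<Rightarrow> bool" where
  "set_universe U \<longleftrightarrow> (\<exists>A\<in>U. infinite A) \<and> (\<forall>A\<in>U. \<forall>B. B \<lesssim> A \<longrightarrow> B \<in> U)"


section \<open>Universal algebras\<close>

text \<open>
  Arities are arbitrary sets, so operations may be infinitary; an \<open>n\<close>-ary operation on \<open>X\<close> acts on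
  the families in \<open>n \<rightarrow>\<^sub>E X\<close>.
\<close>

record 'u alg_type =
  ops :: "'u set"
  arity :: "'u \<Rightarrow> 'u set"

text \<open>
  A type belongs to the universe if the arguments of all operations on a set \<open>X\<close> of the universe,
  \<open>\<Sum>\<^sub>w X^(arity w)\<close>, again form a set of the universe up to bijection. For a Grothendieck universe
  this just says that the set of operations and all arities are in \<open>U\<close>; for the family of all
  subsets of an infinite type it holds for all finitary types. (Operation symbols and
  elements of arities are mere labels, which is why they may be taken from the same type \<open>'u\<close>.)
\<close>

definition type_in_universe :: "'u set set \<Rightarrow> 'u alg_type \<Rightarrow> bool" where
  "type_in_universe U \<Delta> \<longleftrightarrow>
     (\<forall>X\<in>U. \<exists>Y\<in>U. (SIGMA w:ops \<Delta>. arity \<Delta> w \<rightarrow>\<^sub>E X) \<lesssim> Y)"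

record 'u algebra =
  carrier :: "'u set"
  oper :: "'u \<Rightarrow> ('u \<Rightarrow> 'u) \<Rightarrow> 'u"

text \<open>
  Maps are kept extensional throughout, so that equality of structures and of morphisms is
  the intended one.
\<close>

definition is_algebra :: "'u alg_type \<Rightarrow> 'u algebra \<Rightarrow> bool" where
  "is_algebra \<Delta> A \<longleftrightarrow>
     oper A \<in> (\<Pi>\<^sub>E w\<in>ops \<Delta>. (arity \<Delta> w \<rightarrow>\<^sub>E carrier A) \<rightarrow>\<^sub>E carrier A)"

definition algebra_hom :: "'u alg_type \<Rightarrow> 'u algebra \<Rightarrow> 'u algebra \<Rightarrow> ('u \<Rightarrow> 'u) set" where
  "algebra_hom \<Delta> A B =
     {h \<in> carrier A \<rightarrow>\<^sub>E carrier B.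
        \<forall>w\<in>ops \<Delta>. \<forall>t\<in>arity \<Delta> w \<rightarrow>\<^sub>E carrier A.
          h (oper A w t) = oper B w (\<lambda>i\<in>arity \<Delta> w. h (t i))}"

definition Alg :: "'u set set \<Rightarrow> 'u alg_type \<Rightarrow> ('u algebra, 'u \<Rightarrow> 'u) category" where
  "Alg U \<Delta> =
     \<lparr> Obj = {A. carrier A \<in> U \<and> is_algebra \<Delta> A},
       Hom = algebra_hom \<Delta>,
       Ident = (\<lambda>A. \<lambda>x\<in>carrier A. x),
       Comp = (\<lambda>A B C g f. compose (carrier A) g f) \<rparr>"

definition algebraic :: "'u set set \<Rightarrow> ('o, 'm) category \<Rightarrow> bool" where
  "algebraic U K \<longleftrightarrow>
     is_category K \<and>
     (\<exists>\<Delta> S. type_in_universe U \<Delta> \<and> isomorphic_categories K (full_subcategory (Alg U \<Delta>) S))"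

text \<open>
  The type arguments give the types of the objects and morphisms of the categories \<open>K\<close>; they
  only make the quantification over \<open>K\<close> expressible.
\<close>

definition algebraically_universal ::
  "'u set set \<Rightarrow> 'x itself \<Rightarrow> 'y itself \<Rightarrow> ('o, 'm) category \<Rightarrow> bool" where
  "algebraically_universal U _ _ C \<longleftrightarrow>
     (\<forall>K :: ('x, 'y) category. algebraic U K \<longrightarrow> fully_embeds K C)"


section \<open>Graphs\<close>

record 'v graph =
  verts :: "'v set"
  edges :: "'v set set"

definition is_graph :: "'v graph \<Rightarrow> bool" where
  "is_graph G \<longleftrightarrow> (\<forall>e\<in>edges G. e \<subseteq> verts G \<and> card e = 2)"

definition graph_hom :: "'v graph \<Rightarrow> 'w graph \<Rightarrow> ('v \<Rightarrow> 'w) set" where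
  "graph_hom A B =
     {f \<in> verts A \<rightarrow>\<^sub>E verts B. \<forall>x y. {x, y} \<in> edges A \<longrightarrow> {f x, f y} \<in> edges B}"

definition Gra :: "'u set set \<Rightarrow> ('u graph, 'u \<Rightarrow> 'u) category" where
  "Gra U =
     \<lparr> Obj = {A. verts A \<in> U \<and> is_graph A},
       Hom = graph_hom,
       Ident = (\<lambda>A. \<lambda>x\<in>verts A. x),
       Comp = (\<lambda>A B C g f. compose (verts A) g f) \<rparr>"

definition subgraph :: "'v graph \<Rightarrow> 'v graph \<Rightarrow> bool" where
  "subgraph H G \<longleftrightarrow> is_graph H \<and> verts H \<subseteq> verts G \<and> edges H \<subseteq> edges G"

definition isomorphic_graphs :: "'v graph \<Rightarrow> 'w graph \<Rightarrow> bool" where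
  "isomorphic_graphs A B \<longleftrightarrow>
     (\<exists>f. bij_betw f (verts A) (verts B) \<and>
        (\<forall>x\<in>verts A. \<forall>y\<in>verts A. {x, y} \<in> edges A \<longleftrightarrow> {f x, f y} \<in> edges B))"

definition contains_subgraph :: "'v graph \<Rightarrow> 'w graph \<Rightarrow> bool" where
  "contains_subgraph G H \<longleftrightarrow> (\<exists>H'. subgraph H' G \<and> isomorphic_graphs H H')"

definition cycle_graph :: "nat \<Rightarrow> nat graph" where
  "cycle_graph n = \<lparr> verts = {..<n}, edges = (\<lambda>i. {i, Suc i mod n}) ` {..<n} \<rparr>"

text \<open>The path with \<open>n\<close> edges, hence \<open>n + 1\<close> vertices.\<close>

definition path_graph :: "nat \<Rightarrow> nat graph" where
  "path_graph n = \<lparr> verts = {..n}, edges = (\<lambda>i. {i, Suc i}) ` {..<n} \<rparr>"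

definition Y_graph :: "nat graph" where
  "Y_graph = \<lparr> verts = {0, 1, 2, 3}, edges = {{0, 1}, {1, 2}, {1, 3}} \<rparr>"


section \<open>Well-definedness\<close>

lemma is_category_Alg: "is_category (Alg U \<Delta>)"
proof -
  have comp: "compose (carrier A) g f \<in> algebra_hom \<Delta> A C"
    if f: "f \<in> algebra_hom \<Delta> A B" and g: "g \<in> algebra_hom \<Delta> B C" and A: "is_algebra \<Delta> A"
    for A B C f g
  proof -
    have fm: "f \<in> carrier A \<rightarrow>\<^sub>E carrier B" and gm: "g \<in> carrier B \<rightarrow>\<^sub>E carrier C"
      using f g by (auto simp: algebra_hom_def)
    have "compose (carrier A) g f (oper A w t) =
            oper C w (\<lambda>i\<in>arity \<Delta> w. compose (carrier A) g f (t i))"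
      if w: "w \<in> ops \<Delta>" and t: "t \<in> arity \<Delta> w \<rightarrow>\<^sub>E carrier A" for w t
    proof -
      have "oper A w \<in> (arity \<Delta> w \<rightarrow>\<^sub>E carrier A) \<rightarrow>\<^sub>E carrier A"
        using A w unfolding is_algebra_def by (rule PiE_mem)
      then have "oper A w t \<in> carrier A" using t by (rule PiE_mem)
      moreover have t': "(\<lambda>i\<in>arity \<Delta> w. f (t i)) \<in> arity \<Delta> w \<rightarrow>\<^sub>E carrier B"
        using t fm by (auto simp: PiE_iff)
      moreover have "f (oper A w t) = oper B w (\<lambda>i\<in>arity \<Delta> w. f (t i))"
        using f w t by (auto simp: algebra_hom_def)
      moreover have "g (oper B w (\<lambda>i\<in>arity \<Delta> w. f (t i))) =
          oper C w (\<lambda>i\<in>arity \<Delta> w. g ((\<lambda>i\<in>arity \<Delta> w. f (t i)) i))"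
        using g w t' by (auto simp: algebra_hom_def)
      moreover have "(\<lambda>i\<in>arity \<Delta> w. g ((\<lambda>i\<in>arity \<Delta> w. f (t i)) i)) =
          (\<lambda>i\<in>arity \<Delta> w. compose (carrier A) g f (t i))"
        using t by (auto simp: compose_def PiE_iff fun_eq_iff)
      ultimately show ?thesis by (simp add: compose_def)
    qed
    moreover have "compose (carrier A) g f \<in> carrier A \<rightarrow>\<^sub>E carrier C"
      using fm gm by (auto simp: compose_def PiE_iff)
    ultimately show ?thesis by (auto simp: algebra_hom_def)
  qed
  have ident: "(\<lambda>x\<in>carrier A. x) \<in> algebra_hom \<Delta> A A" if A: "is_algebra \<Delta> A" for A
  proof -
    have "(\<lambda>x\<in>carrier A. x) (oper A w t) =
            oper A w (\<lambda>i\<in>arity \<Delta> w. (\<lambda>x\<in>carrier A. x) (t i))"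
      if w: "w \<in> ops \<Delta>" and t: "t \<in> arity \<Delta> w \<rightarrow>\<^sub>E carrier A" for w t
    proof -
      have "oper A w \<in> (arity \<Delta> w \<rightarrow>\<^sub>E carrier A) \<rightarrow>\<^sub>E carrier A"
        using A w unfolding is_algebra_def by (rule PiE_mem)
      then have "oper A w t \<in> carrier A" using t by (rule PiE_mem)
      moreover have "(\<lambda>i\<in>arity \<Delta> w. (\<lambda>x\<in>carrier A. x) (t i)) = t"
        using t by (auto simp: PiE_iff extensional_def fun_eq_iff)
      ultimately show ?thesis by simp
    qed
    then show ?thesis by (auto simp: algebra_hom_def)
  qed
  have ext: "f \<in> carrier A \<rightarrow>\<^sub>E carrier B" if "f \<in> algebra_hom \<Delta> A B" for f A B
    using that by (auto simp: algebra_hom_def)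
  show ?thesis
    unfolding is_category_def
    by (auto simp: Alg_def intro!: comp ident)
       (auto dest!: ext simp: compose_def PiE_iff extensional_def fun_eq_iff)
qed

lemma is_category_Gra: "is_category (Gra U)"
proof -
  have mem: "x \<in> verts A \<and> y \<in> verts A" if "is_graph A" "{x, y} \<in> edges A" for A :: "'a graph" and x y
    using that by (auto simp: is_graph_def)
  show ?thesis
    unfolding is_category_def
    by (auto simp: Gra_def graph_hom_def compose_def PiE_iff extensional_def fun_eq_iff
        dest: mem)
qed

lemma is_category_slice:
  assumes "is_category C" and "G \<in> Obj C"
  shows "is_category (slice_category C G)"
  using assms unfolding is_category_def slice_category_def
  by auto

lemma is_category_full_subcategory: "is_category C \<Longrightarrow> is_category (full_subcategory C S)"
  unfolding is_category_def full_subcategory_def by simp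

lemma is_graph_examples:
  "3 \<le> n \<Longrightarrow> is_graph (cycle_graph n)" "is_graph (path_graph n)" "is_graph Y_graph"
  by (auto simp: is_graph_def cycle_graph_def path_graph_def Y_graph_def mod_Suc
      simp flip: One_nat_def)

end

theory Submission imports Defs begin

text \<open>
  An algebra is encoded by a digraph, and the digraph by a coloured graph.

  Each of the four subgraphs contains a closed walk \<open>w\<close> that is rigid: the path coloured by \<open>w\<close> has no
  colour-preserving walk along itself other than the identity, and the colour of its ends does not
  recur inside. The walks are 0120 for \<open>C\<^sub>3\<close>, 01230 for \<open>C\<^sub>4\<close>, 0121310 for \<open>Y\<close>, and 0123234321210
  for \<open>P\<^sub>4\<close>. Replacing every arc of a digraph by such a path turns digraph homomorphisms into exactly
  the colour-preserving graph homomorphisms.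

  In the digraph of an algebra, the elements \<open>x\<close>, the argument families \<open>(w, t)\<close> and the coordinates
  \<open>(w, t, i)\<close> are linked by arcs \<open>t i \<rightarrow> (w, t, i) \<rightarrow> (w, t) \<rightarrow> w(t)\<close>. What remains is to force homomorphisms to
  respect \<open>w\<close> and \<open>i\<close>. To this end the labels form a well-ordered set \<open>L\<close>, with arcs from smaller to larger
  labels, and every other node \<open>z\<close> lies on a 3-cycle \<open>m \<rightarrow> z \<rightarrow> l \<rightarrow> m\<close> with labels \<open>l < m\<close>, where \<open>m\<close> gives its
  sort. Then the transitive triangles are those inside \<open>L\<close>, so that homomorphisms act on
  \<open>L\<close> by increasing maps. Ladders (chosen increasing sequences converging to the limits of
  cofinality \<open>\<omega>\<close>) make \<open>L\<close> rigid.
\<close>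

section \<open>Replacing arcs by coloured paths\<close>

datatype 'n pvert = Base 'n | Inner 'n 'n nat

definition path_vert :: "nat \<Rightarrow> 'n \<Rightarrow> 'n \<Rightarrow> nat \<Rightarrow> 'n pvert" where
  "path_vert k a b i = (if i = 0 then Base a else if i = k then Base b else Inner a b i)"

definition pverts :: "nat \<Rightarrow> 'n set \<Rightarrow> ('n \<times> 'n) set \<Rightarrow> 'n pvert set" where
  "pverts k N E = Base ` N \<union> {Inner a b i | a b i. (a, b) \<in> E \<and> 0 < i \<and> i < k}"

text \<open>The edges carry no direction. The direction of an arc is recovered from the colours,
  since a rigid word admits no reversal.\<close>

definition pedges :: "nat \<Rightarrow> ('n \<times> 'n) set \<Rightarrow> 'n pvert set set" where
  "pedges k E = {{path_vert k a b i, path_vert k a b (Suc i)} | a b i. (a, b) \<in> E \<and> i < k}"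

text \<open>A base vertex is the common end of all paths that meet there, so this colouring follows
  \<open>w\<close> along every path only when \<open>w k = w 0\<close>.\<close>

fun pcol :: "(nat \<Rightarrow> 'c) \<Rightarrow> 'n pvert \<Rightarrow> 'c" where
  "pcol w (Base a) = w 0"
| "pcol w (Inner a b i) = w i"

text \<open>In \<open>rigid_word\<close>, \<open>p\<close> ranges over the walks on the path \<open>0, \<dots>, k\<close> that preserve the colouring \<open>w\<close>.\<close>

definition rigid_word :: "nat \<Rightarrow> (nat \<Rightarrow> 'c) \<Rightarrow> bool" where
  "rigid_word k w \<longleftrightarrow> 2 \<le> k \<and> w k = w 0 \<and> (\<forall>i. 0 < i \<and> i < k \<longrightarrow> w i \<noteq> w 0) \<and>
     (\<forall>p. (\<forall>i\<le>k. p i \<le> k \<and> w (p i) = w i) \<longrightarrow>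
        (\<forall>i<k. p (Suc i) = Suc (p i) \<or> p i = Suc (p (Suc i))) \<longrightarrow> (\<forall>i\<le>k. p i = i))"

lemma rigid_wordI:
  assumes "2 \<le> k" "w k = w 0" "\<And>i. 0 < i \<Longrightarrow> i < k \<Longrightarrow> w i \<noteq> w 0"
    and "\<And>p i. \<lbrakk>\<And>i. i \<le> k \<Longrightarrow> p i \<le> k; \<And>i. i \<le> k \<Longrightarrow> w (p i) = w i;
            \<And>i. i < k \<Longrightarrow> p (Suc i) = Suc (p i) \<or> p i = Suc (p (Suc i)); i \<le> k\<rbrakk> \<Longrightarrow> p i = i"
  shows "rigid_word k w"
  using assms unfolding rigid_word_def by blast

lemma rigid_wordD:
  assumes "rigid_word k w"
  shows "2 \<le> k" "w k = w 0" "\<And>i. 0 < i \<Longrightarrow> i < k \<Longrightarrow> w i \<noteq> w 0"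
    and "\<And>p i. \<lbrakk>\<And>i. i \<le> k \<Longrightarrow> p i \<le> k; \<And>i. i \<le> k \<Longrightarrow> w (p i) = w i;
            \<And>i. i < k \<Longrightarrow> p (Suc i) = Suc (p i) \<or> p i = Suc (p (Suc i)); i \<le> k\<rbrakk> \<Longrightarrow> p i = i"
  using assms unfolding rigid_word_def by blast+

text \<open>Rigidity depends only on which letters are equal. This allows a walk in a model graph to
  be transported into \<open>G\<close>.\<close>

lemma rigid_word_inj:
  assumes w: "rigid_word k w" and f: "inj_on f S" and S: "\<And>i. i \<le> k \<Longrightarrow> w i \<in> S"
  shows "rigid_word k (\<lambda>i. f (w i))"
proof -
  have eq: "f (w i) = f (w j) \<longleftrightarrow> w i = w j" if "i \<le> k" "j \<le> k" for i j
    using inj_on_eq_iff[OF f] S that by blast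
  show ?thesis
  proof (rule rigid_wordI)
    show "2 \<le> k" "f (w k) = f (w 0)" using rigid_wordD(1,2)[OF w] by auto
    show "f (w i) \<noteq> f (w 0)" if "0 < i" "i < k" for i
      using rigid_wordD(3)[OF w that] eq that by simp
    fix p :: "nat \<Rightarrow> nat" and i
    assume p: "\<And>i. i \<le> k \<Longrightarrow> p i \<le> k" "\<And>i. i \<le> k \<Longrightarrow> f (w (p i)) = f (w i)"
      "\<And>i. i < k \<Longrightarrow> p (Suc i) = Suc (p i) \<or> p i = Suc (p (Suc i))" "i \<le> k"
    show "p i = i"
      by (rule rigid_wordD(4)[OF w]) (use p eq in auto)
  qed
qed

lemma pcol_path_vert: "w k = w 0 \<Longrightarrow> pcol w (path_vert k a b i) = w i"
  by (simp add: path_vert_def)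

lemma path_vert_in_pverts:
  "\<lbrakk>E \<subseteq> N \<times> N; (a, b) \<in> E; i \<le> k\<rbrakk> \<Longrightarrow> path_vert k a b i \<in> pverts k N E"
  by (auto simp: path_vert_def pverts_def)

lemma pedges_subset: "\<lbrakk>E \<subseteq> N \<times> N; e \<in> pedges k E\<rbrakk> \<Longrightarrow> e \<subseteq> pverts k N E"
  unfolding pedges_def by (auto intro!: path_vert_in_pverts)

lemma card_pedge: "\<lbrakk>2 \<le> k; e \<in> pedges k E\<rbrakk> \<Longrightarrow> card e = 2"
  by (auto simp: pedges_def path_vert_def)

text \<open>A walk that has entered the interior of a path can leave it only through the ends; this
  traps the image of a path inside a single path.\<close>

lemma Inner_neighbour:
  assumes "{Inner c d j, y} \<in> pedges k E"
  shows "(c, d) \<in> E \<and> 0 < j \<and> j < k \<and>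
    (\<exists>l\<le>k. y = path_vert k c d l \<and> (l = Suc j \<or> j = Suc l))"
proof -
  obtain a b i where ab: "(a, b) \<in> E" "i < k"
    and e: "{Inner c d j, y} = {path_vert k a b i, path_vert k a b (Suc i)}"
    using assms unfolding pedges_def by blast
  from e consider "Inner c d j = path_vert k a b i" "y = path_vert k a b (Suc i)"
    | "Inner c d j = path_vert k a b (Suc i)" "y = path_vert k a b i"
    by (auto simp: doubleton_eq_iff)
  then show ?thesis
  proof cases
    case 1
    then have "a = c" "b = d" "i = j" "0 < j" by (auto simp: path_vert_def split: if_splits)
    then show ?thesis using 1 ab by (intro conjI exI[of _ "Suc i"]) auto
  next
    case 2
    then have "a = c" "b = d" "Suc i = j" "j \<noteq> k" by (auto simp: path_vert_def split: if_splits)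
    then show ?thesis using 2 ab by (intro conjI exI[of _ i]) auto
  qed
qed

lemma pedges_map:
  assumes "\<And>a b. (a, b) \<in> E \<Longrightarrow> (\<phi> a, \<phi> b) \<in> E'" and "e \<in> pedges k E"
  shows "map_pvert \<phi> ` e \<in> pedges k E'"
proof -
  obtain a b i where ab: "(a, b) \<in> E" "i < k" and e: "e = {path_vert k a b i, path_vert k a b (Suc i)}"
    using assms(2) unfolding pedges_def by blast
  have "map_pvert \<phi> (path_vert k a b i) = path_vert k (\<phi> a) (\<phi> b) i" for i
    by (simp add: path_vert_def)
  then have "map_pvert \<phi> ` e = {path_vert k (\<phi> a) (\<phi> b) i, path_vert k (\<phi> a) (\<phi> b) (Suc i)}"
    unfolding e by simp
  then show ?thesis using ab assms(1) unfolding pedges_def by blast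
qed

lemma pverts_map:
  assumes "\<And>a. a \<in> N \<Longrightarrow> \<phi> a \<in> N'" "\<And>a b. (a, b) \<in> E \<Longrightarrow> (\<phi> a, \<phi> b) \<in> E'" and "v \<in> pverts k N E"
  shows "map_pvert \<phi> v \<in> pverts k N' E'"
  using assms unfolding pverts_def by auto

lemma pcol_map_pvert: "pcol w (map_pvert \<phi> v) = pcol w v"
  by (cases v) auto

text \<open>The colour \<open>w 0\<close> singles out the base vertices, which gives \<phi>. The
  inner colours differ from it, so the interior of the path of an arc is mapped into the interior of
  one path. The positions of the images form a colour-preserving walk, which rigidity makes the
  identity.\<close>

lemma pcol_hom_is_map_pvert:
  fixes N1 :: "'m set" and N2 :: "'n set"
  assumes w: "rigid_word k w" and E1: "E1 \<subseteq> N1 \<times> N1" and E2: "E2 \<subseteq> N2 \<times> N2"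
    and V: "\<And>v. v \<in> pverts k N1 E1 \<Longrightarrow> \<psi> v \<in> pverts k N2 E2"
    and E: "\<And>x y. {x, y} \<in> pedges k E1 \<Longrightarrow> {\<psi> x, \<psi> y} \<in> pedges k E2"
    and C: "\<And>v. v \<in> pverts k N1 E1 \<Longrightarrow> pcol w (\<psi> v) = pcol w v"
  obtains \<phi> where "\<And>a. a \<in> N1 \<Longrightarrow> \<phi> a \<in> N2" "\<And>a b. (a, b) \<in> E1 \<Longrightarrow> (\<phi> a, \<phi> b) \<in> E2"
    "\<And>v. v \<in> pverts k N1 E1 \<Longrightarrow> \<psi> v = map_pvert \<phi> v"
proof -
  note k = rigid_wordD(1)[OF w] and wk = rigid_wordD(2)[OF w] and w0 = rigid_wordD(3)[OF w]
  have isInner: "\<exists>c d j. v = Inner c d j" if "pcol w v \<noteq> w 0" for v :: "'n pvert"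
    using that by (cases v) auto
  have isBase: "\<exists>a'\<in>N2. \<psi> (Base a) = Base a'" if "a \<in> N1" for a
  proof -
    have "Base a \<in> pverts k N1 E1" using that by (auto simp: pverts_def)
    from V[OF this] C[OF this] show ?thesis
      using w0 by (auto simp: pverts_def)
  qed
  define \<phi> where "\<phi> a = (SOME a'. a' \<in> N2 \<and> \<psi> (Base a) = Base a')" for a
  have \<phi>: "\<phi> a \<in> N2" "\<psi> (Base a) = Base (\<phi> a)" if "a \<in> N1" for a
    using someI_ex[OF isBase[OF that, unfolded Bex_def]] unfolding \<phi>_def by blast+
  have arc: "(\<phi> a, \<phi> b) \<in> E2 \<and> (\<forall>i\<le>k. \<psi> (path_vert k a b i) = path_vert k (\<phi> a) (\<phi> b) i)"
    if ab: "(a, b) \<in> E1" for a b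
  proof -
    define q where "q i = \<psi> (path_vert k a b i)" for i
    have ab': "a \<in> N1" "b \<in> N1" using ab E1 by auto
    have qe: "{q i, q (Suc i)} \<in> pedges k E2" if "i < k" for i
      unfolding q_def by (rule E) (use that ab in \<open>auto simp: pedges_def\<close>)
    have qc: "pcol w (q i) = w i" if "i \<le> k" for i
      unfolding q_def using C[OF path_vert_in_pverts[OF E1 ab that]] pcol_path_vert[of w, OF wk] by metis
    have q0: "q 0 = Base (\<phi> a)" and qk: "q k = Base (\<phi> b)"
      using \<phi>[OF ab'(1)] \<phi>[OF ab'(2)] k by (auto simp: q_def path_vert_def)
    have "pcol w (q 1) \<noteq> w 0" using qc[of 1] w0[of 1] k by simp
    then obtain c d j1 where q1: "q 1 = Inner c d j1" using isInner by blast
    \<comment> \<open>The colour of \<open>q (Suc i)\<close> is not \<open>w 0\<close>, so the walk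
      has not yet reached an end of the path of \<open>(c, d)\<close>.\<close>
    have inner: "\<exists>j. q (Suc i) = Inner c d j" if "Suc i < k" for i
      using that
    proof (induction i)
      case 0
      then show ?case using q1 by auto
    next
      case (Suc i)
      then obtain j where j: "q (Suc i) = Inner c d j" by auto
      have "{Inner c d j, q (Suc (Suc i))} \<in> pedges k E2" using qe[of "Suc i"] Suc.prems j by simp
      from Inner_neighbour[OF this] obtain l where l: "q (Suc (Suc i)) = path_vert k c d l" by blast
      have "pcol w (q (Suc (Suc i))) \<noteq> w 0" using qc w0 Suc.prems by simp
      then show ?case using isInner l by (auto simp: path_vert_def split: if_splits)
    qed
    define p' where "p' i = (SOME j. q i = Inner c d j)" for i
    have p': "q i = Inner c d (p' i)" if "0 < i" "i < k" for i
      using inner[of "i - 1"] that someI_ex[of "\<lambda>j. q i = Inner c d j"] unfolding p'_def by auto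
    \<comment> \<open>If \<open>c = d\<close>, both ends of the path are the same vertex and the
      position of \<open>q 0\<close> cannot be read off from it. So \<open>p0\<close> is taken next
      to \<open>p' 1\<close>, and likewise \<open>pk\<close> next to
      \<open>p' (k - 1)\<close>.\<close>
    have "{Inner c d (p' 1), q 0} \<in> pedges k E2" using qe[of 0] p'[of 1] k by (simp add: insert_commute)
    from Inner_neighbour[OF this]
    obtain p0 where cd: "(c, d) \<in> E2" and p0: "p0 \<le> k" "q 0 = path_vert k c d p0" "p0 = Suc (p' 1) \<or> p' 1 = Suc p0"
      by blast
    have "{Inner c d (p' (k - 1)), q k} \<in> pedges k E2" using qe[of "k - 1"] p'[of "k - 1"] k by simp
    from Inner_neighbour[OF this]
    obtain pk where pk: "pk \<le> k" "q k = path_vert k c d pk" "pk = Suc (p' (k - 1)) \<or> p' (k - 1) = Suc pk"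
      by blast
    define p where "p = p'(0 := p0, k := pk)"
    have pin: "p i = p' i \<and> 0 < p i \<and> p i < k" if "0 < i" "i < k" for i
    proof -
      have "{Inner c d (p' i), q (Suc i)} \<in> pedges k E2" using qe[of i] p' that by simp
      from Inner_neighbour[OF this] show ?thesis using that by (simp add: p_def)
    qed
    have p: "p i \<le> k" "q i = path_vert k c d (p i)" if "i \<le> k" for i
    proof -
      consider "i = 0" | "i = k" | "0 < i" "i < k" using \<open>i \<le> k\<close> by linarith
      then have "p i \<le> k \<and> q i = path_vert k c d (p i)"
      proof cases
        case 1 then show ?thesis using p0 k by (simp add: p_def)
      next
        case 2 then show ?thesis using pk by (simp add: p_def)
      next
        case 3 then show ?thesis using pin[OF 3] p'[OF 3] by (auto simp: path_vert_def)
      qed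
      then show "p i \<le> k" "q i = path_vert k c d (p i)" by auto
    qed
    have step: "p (Suc i) = Suc (p i) \<or> p i = Suc (p (Suc i))" if i: "i < k" for i
    proof (cases "i = 0")
      case True
      then show ?thesis using p0(3) k by (auto simp: p_def)
    next
      case False
      show ?thesis
      proof (cases "Suc i = k")
        case True
        then show ?thesis using pk(3) False by (auto simp: p_def)
      next
        case F: False
        have "{Inner c d (p' i), q (Suc i)} \<in> pedges k E2" using qe[of i] p' i False by simp
        moreover have "q (Suc i) = Inner c d (p' (Suc i))" using p' i F by simp
        ultimately have "{Inner c d (p' i), Inner c d (p' (Suc i))} \<in> pedges k E2" by simp
        from Inner_neighbour[OF this] obtain l where "Inner c d (p' (Suc i)) = path_vert k c d l"
          "l = Suc (p' i) \<or> p' i = Suc l"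
          by blast
        then show ?thesis using pin[of i] pin[of "Suc i"] i F False
          by (auto simp: path_vert_def split: if_splits)
      qed
    qed
    have "w (p i) = w i" if "i \<le> k" for i
      using qc[OF that] p(2)[OF that] pcol_path_vert[of w, OF wk] by metis
    from rigid_wordD(4)[OF w p(1) this step] have pid: "p i = i" if "i \<le> k" for i
      using that by blast
    \<comment> \<open>With \<open>p\<close> the identity, the path of \<open>(a, b)\<close> runs
      along that of \<open>(c, d)\<close> in the same direction.\<close>
    have "Base (\<phi> a) = Base c" "Base (\<phi> b) = Base d"
      using p(2)[of 0] pid[of 0] p(2)[of k] pid[of k] q0 qk k by (auto simp: path_vert_def)
    then show ?thesis using cd p(2) pid by (auto simp: q_def)
  qed
  show thesis
  proof (rule that)
    show "\<phi> a \<in> N2" if "a \<in> N1" for a using \<phi> that by blast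
    show "(\<phi> a, \<phi> b) \<in> E2" if "(a, b) \<in> E1" for a b using arc that by blast
    show "\<psi> v = map_pvert \<phi> v" if "v \<in> pverts k N1 E1" for v
    proof -
      from that consider a where "a \<in> N1" "v = Base a"
        | a b i where "(a, b) \<in> E1" "0 < i" "i < k" "v = Inner a b i"
        unfolding pverts_def by blast
      then show ?thesis
      proof cases
        case 1 then show ?thesis using \<phi> by simp
      next
        case 2
        then have "v = path_vert k a b i" by (simp add: path_vert_def)
        moreover have "\<psi> (path_vert k a b i) = path_vert k (\<phi> a) (\<phi> b) i"
          using arc[OF 2(1)] 2(3) by simp
        ultimately show ?thesis using 2 by (simp add: path_vert_def)
      qed
    qed
  qed
qed

text \<open>Reduces rigidity of a concrete word to arithmetic: \<open>filter\<close> lists, for each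
  position, the places with the same letter, and the steps of \<open>p\<close> relate neighbouring
  positions.\<close>

lemma rigid_word_list:
  assumes "2 \<le> k" "ws ! k = ws ! 0" "\<forall>i\<in>set [1..<k]. ws ! i \<noteq> ws ! 0"
    and "\<And>p. \<lbrakk>\<And>i. i \<le> k \<Longrightarrow> p i \<in> set (filter (\<lambda>j. ws ! j = ws ! i) [0..<Suc k]);
            \<And>i. i < k \<Longrightarrow> p (Suc i) = Suc (p i) \<or> p i = Suc (p (Suc i))\<rbrakk> \<Longrightarrow>
            list_all (\<lambda>i. p i = i) [0..<Suc k]"
  shows "rigid_word k (\<lambda>i. ws ! i)"
proof (rule rigid_wordI)
  fix p :: "nat \<Rightarrow> nat" and i
  assume p: "\<And>i. i \<le> k \<Longrightarrow> p i \<le> k" "\<And>i. i \<le> k \<Longrightarrow> ws ! p i = ws ! i"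
    "\<And>i. i < k \<Longrightarrow> p (Suc i) = Suc (p i) \<or> p i = Suc (p (Suc i))" "i \<le> k"
  have "list_all (\<lambda>i. p i = i) [0..<Suc k]"
    by (rule assms(4)) (use p in \<open>auto simp: less_Suc_eq_le simp del: upt_Suc\<close>)
  then show "p i = i" using \<open>i \<le> k\<close> by (auto simp: list_all_iff simp del: upt_Suc)
qed (use assms in auto)

section \<open>Rigid closed walks in the four subgraphs\<close>

lemma rigid_word_3: "rigid_word 3 (\<lambda>i. [0, 1, 2, 0::nat] ! i)"
proof (rule rigid_word_list, goal_cases)
  case (4 p)
  have m: "p 1 = 1" "p 2 = 2" "p 0 = 0 \<or> p 0 = 3" "p 3 = 0 \<or> p 3 = 3"
    using 4(1)[of 0] 4(1)[of 1] 4(1)[of 2] 4(1)[of 3] by (auto simp: upt_rec nth_Cons')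
  have s: "p 1 = p 0 + 1 \<or> p 0 = p 1 + 1"
    "p 2 = p 1 + 1 \<or> p 1 = p 2 + 1"
    "p 3 = p 2 + 1 \<or> p 2 = p 3 + 1"
    using 4(2)[of 0] 4(2)[of 1] 4(2)[of 2] by (simp_all add: eval_nat_numeral)
  \<comment> \<open>The letters 1 and 2 are unique, so \<open>p\<close> fixes their positions; each
    end must then take the only 0 adjacent to a fixed position.\<close>
  have a: "p 0 = 0" "p 1 = 1" "p 2 = 2" "p 3 = 3"
    using m(1) m(2) m(3) m(4)  s(1) s(2) s(3) by arith+
  show ?case using a by (simp add: upt_rec eval_nat_numeral)
qed (simp_all add: upt_rec)

lemma rigid_word_4: "rigid_word 4 (\<lambda>i. [0, 1, 2, 3, 0::nat] ! i)"
proof (rule rigid_word_list, goal_cases)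
  case (4 p)
  have m: "p 1 = 1" "p 2 = 2" "p 3 = 3" "p 0 = 0 \<or> p 0 = 4" "p 4 = 0 \<or> p 4 = 4"
    using 4(1)[of 0] 4(1)[of 1] 4(1)[of 2] 4(1)[of 3] 4(1)[of 4] by (auto simp: upt_rec nth_Cons')
  have s: "p 1 = p 0 + 1 \<or> p 0 = p 1 + 1"
    "p 2 = p 1 + 1 \<or> p 1 = p 2 + 1"
    "p 3 = p 2 + 1 \<or> p 2 = p 3 + 1"
    "p 4 = p 3 + 1 \<or> p 3 = p 4 + 1"
    using 4(2)[of 0] 4(2)[of 1] 4(2)[of 2] 4(2)[of 3] by (simp_all add: eval_nat_numeral)
  have a: "p 0 = 0" "p 1 = 1" "p 2 = 2" "p 3 = 3" "p 4 = 4"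
    using m(1) m(2) m(3) m(4) m(5)  s(1) s(2) s(3) s(4) by arith+
  show ?case using a by (simp add: upt_rec eval_nat_numeral)
qed (simp_all add: upt_rec)

text \<open>Positions 2 and 4 carry the unique letters 2 and 3, hence are fixed. This forces the
  position between them, and each end is two steps from one of them, too close to be exchanged with
  the other end.\<close>

lemma rigid_word_6: "rigid_word 6 (\<lambda>i. [0, 1, 2, 1, 3, 1, 0::nat] ! i)"
proof (rule rigid_word_list, goal_cases)
  case (4 p)
  have m: "p 2 = 2" "p 4 = 4" "p 0 = 0 \<or> p 0 = 6" "p 6 = 0 \<or> p 6 = 6"
    using 4(1)[of 0] 4(1)[of 2] 4(1)[of 4] 4(1)[of 6] by (auto simp: upt_rec nth_Cons')
  have s: "p 1 = p 0 + 1 \<or> p 0 = p 1 + 1"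
    "p 2 = p 1 + 1 \<or> p 1 = p 2 + 1"
    "p 3 = p 2 + 1 \<or> p 2 = p 3 + 1"
    "p 4 = p 3 + 1 \<or> p 3 = p 4 + 1"
    "p 5 = p 4 + 1 \<or> p 4 = p 5 + 1"
    "p 6 = p 5 + 1 \<or> p 5 = p 6 + 1"
    using 4(2)[of 0] 4(2)[of 1] 4(2)[of 2] 4(2)[of 3] 4(2)[of 4] 4(2)[of 5] by (simp_all add: eval_nat_numeral)
  have a: "p 0 = 0" "p 1 = 1" "p 2 = 2"
    using m(1) m(3)  s(1) s(2) by arith+
  have b: "p 3 = 3" "p 4 = 4"
    using m(1) m(2)  s(3) s(4) by arith+
  have c: "p 5 = 5" "p 6 = 6"
    using m(2) m(4)  s(5) s(6) by arith+
  show ?case using a b c by (simp add: upt_rec eval_nat_numeral)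
qed (simp_all add: upt_rec)

text \<open>The unique letter 4 fixes position 6. Three steps from 12 never lead to a letter 3,
  hence \<open>p 0 = 0\<close> and \<open>p 3 = 3\<close>. The letters at 9 and 12 then leave only
  these positions within reach, and between the anchors 0, 3, 6, 9, 12 three steps cover a distance
  of three, so the walk is straight.\<close>

lemma rigid_word_12: "rigid_word 12 (\<lambda>i. [0, 1, 2, 3, 2, 3, 4, 3, 2, 1, 2, 1, 0::nat] ! i)"
proof (rule rigid_word_list, goal_cases)
  case (4 p)
  have m: "p 0 = 0 \<or> p 0 = 12" "p 2 = 2 \<or> p 2 = 4 \<or> p 2 = 8 \<or> p 2 = 10"
    "p 3 = 3 \<or> p 3 = 5 \<or> p 3 = 7" "p 6 = 6" "p 9 = 1 \<or> p 9 = 9 \<or> p 9 = 11" "p 12 = 0 \<or> p 12 = 12"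
    "p 8 = 2 \<or> p 8 = 4 \<or> p 8 = 8 \<or> p 8 = 10"
    subgoal using 4(1)[of 0] by (simp add: upt_rec eval_nat_numeral)
    subgoal using 4(1)[of 2] by (simp add: upt_rec eval_nat_numeral)
    subgoal using 4(1)[of 3] by (simp add: upt_rec eval_nat_numeral)
    subgoal using 4(1)[of 6] by (simp add: upt_rec eval_nat_numeral)
    subgoal using 4(1)[of 9] by (simp add: upt_rec eval_nat_numeral)
    subgoal using 4(1)[of 12] by (simp add: upt_rec eval_nat_numeral)
    subgoal using 4(1)[of 8] by (simp add: upt_rec eval_nat_numeral)
    done
  have s: "p 1 = p 0 + 1 \<or> p 0 = p 1 + 1"
    "p 2 = p 1 + 1 \<or> p 1 = p 2 + 1"
    "p 3 = p 2 + 1 \<or> p 2 = p 3 + 1"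
    "p 4 = p 3 + 1 \<or> p 3 = p 4 + 1"
    "p 5 = p 4 + 1 \<or> p 4 = p 5 + 1"
    "p 6 = p 5 + 1 \<or> p 5 = p 6 + 1"
    "p 7 = p 6 + 1 \<or> p 6 = p 7 + 1"
    "p 8 = p 7 + 1 \<or> p 7 = p 8 + 1"
    "p 9 = p 8 + 1 \<or> p 8 = p 9 + 1"
    "p 10 = p 9 + 1 \<or> p 9 = p 10 + 1"
    "p 11 = p 10 + 1 \<or> p 10 = p 11 + 1"
    "p 12 = p 11 + 1 \<or> p 11 = p 12 + 1"
    using 4(2)[of 0] 4(2)[of 1] 4(2)[of 2] 4(2)[of 3] 4(2)[of 4] 4(2)[of 5] 4(2)[of 6] 4(2)[of 7] 4(2)[of 8] 4(2)[of 9] 4(2)[of 10] 4(2)[of 11] by (simp_all add: eval_nat_numeral)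
  have a: "p 0 = 0" "p 1 = 1" "p 2 = 2" "p 3 = 3"
    using m(1) m(2) m(3)  s(1) s(2) s(3) by arith+
  have b: "p 4 = 4" "p 5 = 5" "p 6 = 6"
    using m(4) a s(4) s(5) s(6) by arith+
  have c: "p 7 = 7" "p 8 = 8" "p 9 = 9"
    using m(4) m(5) m(7)  s(7) s(8) s(9) by arith+
  have d: "p 10 = 10" "p 11 = 11" "p 12 = 12"
    using m(6) c s(10) s(11) s(12) by arith+
  show ?case using a b c d by (simp add: upt_rec eval_nat_numeral)
qed (simp_all add: upt_rec)

text \<open>An isomorphism onto a subgraph is injective and sends edges to edges of
  \<open>G\<close>; it therefore carries both the rigidity and the walk to \<open>G\<close>.\<close>

lemma rigid_closed_walk:
  assumes c: "contains_subgraph G H" and w: "rigid_word k w"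
    and e: "\<And>i. i < k \<Longrightarrow> {w i, w (Suc i)} \<in> edges H" and H: "is_graph H" and G: "is_graph G"
  obtains w' where "rigid_word k w'" "\<And>i. i < k \<Longrightarrow> {w' i, w' (Suc i)} \<in> edges G"
proof -
  obtain H' f where H': "subgraph H' G" and f: "bij_betw f (verts H) (verts H')"
    and fe: "\<forall>x\<in>verts H. \<forall>y\<in>verts H. {x, y} \<in> edges H \<longleftrightarrow> {f x, f y} \<in> edges H'"
    using c unfolding contains_subgraph_def isomorphic_graphs_def by blast
  have v: "w i \<in> verts H \<and> w (Suc i) \<in> verts H" if "i < k" for i
    using e[OF that] H unfolding is_graph_def by blast
  \<comment> \<open>The last vertex \<open>w k\<close> is reached as the successor of
    \<open>w (k - 1)\<close>.\<close>
  have v': "w i \<in> verts H" if "i \<le> k" for i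
    using v[of i] v[of "i - 1"] that rigid_wordD(1)[OF w] by (cases "i = k") auto
  show thesis
  proof (rule that)
    show "rigid_word k (\<lambda>i. f (w i))"
      using rigid_word_inj[OF w bij_betw_imp_inj_on[OF f] v'] .
    show "{f (w i), f (w (Suc i))} \<in> edges G" if "i < k" for i
      using fe v[OF that] e[OF that] H' unfolding subgraph_def by blast
  qed
qed

lemma exists_rigid_closed_walk:
  assumes G: "is_graph G"
    and c: "contains_subgraph G (cycle_graph 3) \<or> contains_subgraph G (cycle_graph 4) \<or>
         contains_subgraph G (path_graph 4) \<or> contains_subgraph G Y_graph"
  obtains k w where "rigid_word k w" "\<And>i. i < k \<Longrightarrow> {w i, w (Suc i)} \<in> edges G"
proof -
  have e: "edges (cycle_graph 3) = {{0, 1}, {1, 2}, {2, 0}}"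
    "edges (cycle_graph 4) = {{0, 1}, {1, 2}, {2, 3}, {3, 0}}"
    "edges Y_graph = {{0, 1}, {1, 2}, {1, 3}}"
    "edges (path_graph 4) = {{0, 1}, {1, 2}, {2, 3}, {3, 4}}"
    by (auto simp: cycle_graph_def path_graph_def Y_graph_def lessThan_nat_numeral lessThan_Suc)
  have "\<forall>i\<in>set [0..<3]. {[0, 1, 2, 0] ! i, [0, 1, 2, 0] ! Suc i} \<in> edges (cycle_graph 3)"
    unfolding e by (simp add: upt_rec doubleton_eq_iff)
  then have 3: "{[0, 1, 2, 0] ! i, [0, 1, 2, 0] ! Suc i} \<in> edges (cycle_graph 3)" if "i < 3" for i
    using that by simp
  have "\<forall>i\<in>set [0..<4]. {[0, 1, 2, 3, 0] ! i, [0, 1, 2, 3, 0] ! Suc i} \<in> edges (cycle_graph 4)"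
    unfolding e by (simp add: upt_rec doubleton_eq_iff)
  then have 4: "{[0, 1, 2, 3, 0] ! i, [0, 1, 2, 3, 0] ! Suc i} \<in> edges (cycle_graph 4)" if "i < 4" for i
    using that by simp
  have "\<forall>i\<in>set [0..<6]. {[0, 1, 2, 1, 3, 1, 0] ! i, [0, 1, 2, 1, 3, 1, 0] ! Suc i} \<in> edges (Y_graph)"
    unfolding e by (simp add: upt_rec doubleton_eq_iff)
  then have Y: "{[0, 1, 2, 1, 3, 1, 0] ! i, [0, 1, 2, 1, 3, 1, 0] ! Suc i} \<in> edges (Y_graph)" if "i < 6" for i
    using that by simp
  have "\<forall>i\<in>set [0..<12]. {[0, 1, 2, 3, 2, 3, 4, 3, 2, 1, 2, 1, 0] ! i, [0, 1, 2, 3, 2, 3, 4, 3, 2, 1, 2, 1, 0] ! Suc i} \<in> edges (path_graph 4)"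
    unfolding e by (simp add: upt_rec doubleton_eq_iff)
  then have P: "{[0, 1, 2, 3, 2, 3, 4, 3, 2, 1, 2, 1, 0] ! i, [0, 1, 2, 3, 2, 3, 4, 3, 2, 1, 2, 1, 0] ! Suc i} \<in> edges (path_graph 4)" if "i < 12" for i
    using that by simp
  have g: "is_graph (cycle_graph 3)" "is_graph (cycle_graph 4)" using is_graph_examples by simp_all
  from c show thesis
    using rigid_closed_walk[OF _ rigid_word_3 3 g(1) G] rigid_closed_walk[OF _ rigid_word_4 4 g(2) G]
      rigid_closed_walk[OF _ rigid_word_6 Y is_graph_examples(3) G]
      rigid_closed_walk[OF _ rigid_word_12 P is_graph_examples(2) G] that
    by metis
qed

section \<open>A rigid structure on a well-ordered set\<close>

text \<open>A cofinal sequence below \<open>d\<close>, not assumed monotone. Each \<open>y\<close>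
  below \<open>d\<close> is strictly below some member, so \<open>d\<close> is a limit of cofinality
  \<omega>.\<close>

definition omega_limit :: "('l \<Rightarrow> 'l \<Rightarrow> bool) \<Rightarrow> 'l set \<Rightarrow> 'l \<Rightarrow> (nat \<Rightarrow> 'l) \<Rightarrow> bool" where
  "omega_limit lt L d s \<longleftrightarrow> d \<in> L \<and> (\<forall>n. s n \<in> L \<and> lt (s n) d) \<and> (\<forall>y\<in>L. lt y d \<longrightarrow> (\<exists>n. lt y (s n)))"

text \<open>
  If the increasing map \<open>f\<close> moves \<open>x\<close>, let \<open>d\<close> be the supremum of the iterates \<open>f\<^sup>n x\<close>. The ladder of
  \<open>f d\<close> is the image of the ladder of \<open>d\<close>, hence bounded by \<open>d\<close>, so \<open>f\<close> fixes \<open>d\<close> and every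
  rung of its ladder. A fixed rung above \<open>x\<close> would bound all iterates of \<open>x\<close>, contradicting the choice of \<open>d\<close>.
\<close>

lemma ladder_rigid:
  assumes wf: "wfp lt" and tr: "transp lt" and tot: "totalp_on L lt"
    and f: "\<And>x. x \<in> L \<Longrightarrow> f x \<in> L" and mono: "\<And>x y. \<lbrakk>x \<in> L; y \<in> L; lt x y\<rbrakk> \<Longrightarrow> lt (f x) (f y)"
    and top: "m \<in> L" "\<And>x. x \<in> L \<Longrightarrow> x = m \<or> lt x m"
    and lad: "\<And>d s. omega_limit lt L d s \<Longrightarrow> omega_limit lt L d (\<eta> d)"
    and flad: "\<And>d n. omega_limit lt L d (\<eta> d) \<Longrightarrow> omega_limit lt L (f d) (\<eta> (f d)) \<and> f (\<eta> d n) = \<eta> (f d) n"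
    and x: "x \<in> L"
  shows "f x = x"
proof (rule ccontr)
  assume ne: "f x \<noteq> x"
  have irr: "\<not> lt y y" for y using wf by (metis wfp_imp_irreflp irreflpD)
  have trD: "lt a b \<Longrightarrow> lt b c \<Longrightarrow> lt a c" for a b c using tr by (blast dest: transpD)
  have lin: "a = b \<or> lt a b \<or> lt b a" if "a \<in> L" "b \<in> L" for a b
    using tot that by (auto simp: totalp_on_def)
  \<comment> \<open>An increasing map on a well-order moves no point down: with \<open>f y\<close>
    below \<open>y\<close>, also \<open>f (f y)\<close> would be below \<open>f y\<close>, against
    the induction hypothesis.\<close>
  have ge: "\<not> lt (f y) y" if "y \<in> L" for y
    using wf that
  proof (induction y rule: wfp_induct_rule)
    case (less y)
    show ?case
    proof
      assume l: "lt (f y) y"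
      have "\<not> lt (f (f y)) (f y)" using less.IH[OF l f[OF less.prems]] .
      moreover have "lt (f (f y)) (f y)" using mono[OF f[OF less.prems] less.prems l] .
      ultimately show False by blast
    qed
  qed
  define s where "s n = (f ^^ n) x" for n
  have sL: "s n \<in> L" for n unfolding s_def by (induction n) (use x f in auto)
  have sinc: "lt (s n) (s (Suc n))" for n
  proof (induction n)
    case 0
    then show ?case using lin[OF x f[OF x]] ne ge[OF x] by (auto simp: s_def)
  next
    case (Suc n)
    then show ?case using mono[OF sL sL Suc] by (simp add: s_def)
  qed
  have "f m = m" using top(2)[OF f[OF top(1)]] ge[OF top(1)] by blast
  \<comment> \<open>The iterates increase strictly and stay within the greatest element, so
    \<open>m\<close> is a strict upper bound; \<open>d\<close> is the least one.\<close>
  then have "lt (s n) m" for n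
    using top(2)[OF sL, of n] top(2)[OF sL, of "Suc n"] sinc[of n] irr trD by metis
  then have "m \<in> {y \<in> L. \<forall>n. lt (s n) y}" using top by blast
  then obtain d where d: "d \<in> L" "\<And>n. lt (s n) d" and dmin: "\<And>y. lt y d \<Longrightarrow> y \<in> L \<Longrightarrow> \<exists>n. \<not> lt (s n) y"
    using wf[unfolded wfp_iff_ex_minimal, rule_format, of "{y \<in> L. \<forall>n. lt (s n) y}"] by blast
  have below: "\<exists>n. lt y (s n)" if y: "y \<in> L" "lt y d" for y
  proof -
    obtain n where "\<not> lt (s n) y" using dmin y by blast
    then have "y = s n \<or> lt y (s n)" using lin[OF sL[of n] y(1)] by auto
    then have "lt y (s (Suc n))" using sinc trD by metis
    then show ?thesis by blast
  qed
  \<comment> \<open>The iterates witness that \<open>d\<close> is a limit, so that \<open>d\<close>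
    has a ladder.\<close>
  have "omega_limit lt L d s" using d sL below by (auto simp: omega_limit_def)
  then have dl: "omega_limit lt L d (\<eta> d)" by (rule lad)
  then have fdl: "omega_limit lt L (f d) (\<eta> (f d))" and fe: "\<And>n. f (\<eta> d n) = \<eta> (f d) n" using flad by auto
  have eL: "\<eta> d n \<in> L" "lt (\<eta> d n) d" for n using dl by (auto simp: omega_limit_def)
  have fbelow: "lt (f (\<eta> d n)) d" for n
  proof -
    obtain m where "lt (\<eta> d n) (s m)" using below eL by blast
    then have "lt (f (\<eta> d n)) (s (Suc m))" using mono[OF eL(1) sL] by (simp add: s_def)
    then show ?thesis using d trD by blast
  qed
  have fd: "f d = d"
  proof (rule ccontr)
    assume "f d \<noteq> d"
    then have "lt d (f d)" using lin[OF d(1) f[OF d(1)]] ge[OF d(1)] by auto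
    then obtain n where "lt d (\<eta> (f d) n)" using fdl d by (auto simp: omega_limit_def)
    then show False using fbelow[of n] fe irr trD by metis
  qed
  then have fixed: "f (\<eta> d n) = \<eta> d n" for n using fe by simp
  have "lt x d" using d(2)[of 0] by (simp add: s_def)
  then obtain n where n: "lt x (\<eta> d n)" using dl x by (auto simp: omega_limit_def)
  have "lt (s m) (\<eta> d n)" for m
  proof (induction m)
    case 0 then show ?case using n by (simp add: s_def)
  next
    case (Suc m)
    then show ?case using mono[OF sL eL(1) Suc] fixed by (simp add: s_def)
  qed
  moreover obtain m where "lt (\<eta> d n) (s m)" using below eL by blast
  ultimately show False using irr trD by blast
qed

section \<open>The digraph of an algebra\<close>

text \<open>
  \<open>LT w\<close> and \<open>LD w i\<close> label the argument families \<open>(w, t)\<close> and the coordinates \<open>(w, t, i)\<close>; all elements share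
  the label \<open>LX\<close>. The labels \<open>Mark 1\<close>, \<open>\<dots>\<close>, \<open>Mark 6\<close> name the sorts and lie on top of the order; because of
  \<open>Mark 0\<close>, no sort is a limit of smaller labels.
\<close>

datatype 'u lab = LX | LT 'u | LD 'u 'u | Mark nat

fun lrank :: "'u lab \<Rightarrow> nat" where
  "lrank (Mark i) = Suc i"
| "lrank _ = 0"

text \<open>An arbitrary well-order of the type. In \<open>llt\<close> it decides only among the
  labels of rank 0, since each positive rank belongs to a single mark.\<close>

definition lab_wo :: "'u lab rel" where
  "lab_wo = (SOME r. Well_order r \<and> Field r = UNIV)"

definition llt :: "'u lab \<Rightarrow> 'u lab \<Rightarrow> bool" where
  "llt x y \<longleftrightarrow> lrank x < lrank y \<or> lrank x = lrank y \<and> (x, y) \<in> lab_wo - Id"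

lemma lab_wo: "Well_order (lab_wo :: 'a lab rel)" "Field (lab_wo :: 'a lab rel) = UNIV"
  unfolding lab_wo_def using someI_ex[OF well_ordering] by auto

lemma wfp_llt: "wfp llt"
proof -
  have "wf (lab_wo - Id :: 'a lab rel)" using lab_wo(1)[where 'a = 'a] by (simp add: well_order_on_def)
  then have "wf (inv_image (less_than <*lex*> (lab_wo - Id)) (\<lambda>x :: 'a lab. (lrank x, x)))"
    by (intro wf_inv_image wf_lex_prod wf_less_than)
  moreover have "{(x :: 'a lab, y). llt x y} = inv_image (less_than <*lex*> (lab_wo - Id)) (\<lambda>x. (lrank x, x))"
    by (auto simp: llt_def)
  ultimately show ?thesis by (simp add: wfp_def)
qed

lemma transp_llt: "transp llt"
proof -
  have "trans (lab_wo :: 'a lab rel)" "antisym (lab_wo :: 'a lab rel)" using lab_wo(1)[where 'a = 'a]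
    by (auto simp: well_order_on_def linear_order_on_def partial_order_on_def preorder_on_def)
  then have "trans (lab_wo - Id :: 'a lab rel)" by (rule trans_diff_Id)
  then show ?thesis by (auto simp: transp_def llt_def dest: transD)
qed

lemma totalp_llt: "totalp_on L llt"
proof -
  have "total (lab_wo :: 'a lab rel)" using lab_wo[where 'a = 'a]
    by (metis well_order_on_def linear_order_on_def)
  then show ?thesis unfolding totalp_on_def total_on_def llt_def by (metis DiffI UNIV_I linorder_neqE_nat pair_in_Id_conv)
qed

lemma llt_irrefl [simp]: "\<not> llt x x"
  by (auto simp: llt_def)

lemma llt_trans: "\<lbrakk>llt x y; llt y z\<rbrakk> \<Longrightarrow> llt x z"
  using transp_llt by (blast dest: transpD)

lemma llt_Mark_right [simp]: "llt x (Mark k) \<longleftrightarrow> lrank x \<le> k"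
  by (cases x) (auto simp: llt_def)

lemma llt_Mark_left [simp]: "llt (Mark k) x \<longleftrightarrow> Suc k < lrank x"
  by (cases x) (auto simp: llt_def)


text \<open>
  The nodes \<open>NU d n\<close> and \<open>NV d n\<close> form a path \<open>NU d 0 \<rightarrow> NV d 0 \<rightarrow> NU d 1 \<rightarrow> NV d 1 \<rightarrow> \<dots>\<close> that encodes the ladder
  of \<open>d\<close>: \<open>NU d n\<close> points to \<open>d\<close> and \<open>NV d n\<close> to its \<open>n\<close>-th rung.
\<close>

datatype 'u node = NL "'u lab" | NX 'u | NT 'u "'u \<Rightarrow> 'u" | ND 'u "'u \<Rightarrow> 'u" 'u
  | NU "'u lab" nat | NV "'u lab" nat

definition labs :: "'u alg_type \<Rightarrow> 'u lab set" where
  "labs \<Delta> = {LX} \<union> LT ` ops \<Delta> \<union> {LD w i | w i. w \<in> ops \<Delta> \<and> i \<in> arity \<Delta> w} \<union> Mark ` {..6}"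

definition is_lim :: "'u alg_type \<Rightarrow> 'u lab \<Rightarrow> bool" where
  "is_lim \<Delta> d \<longleftrightarrow> (\<exists>s. omega_limit llt (labs \<Delta>) d s)"

definition ladder :: "'u alg_type \<Rightarrow> 'u lab \<Rightarrow> nat \<Rightarrow> 'u lab" where
  "ladder \<Delta> d = (SOME s. omega_limit llt (labs \<Delta>) d s)"

definition nodes :: "'u alg_type \<Rightarrow> 'u set \<Rightarrow> 'u node set" where
  "nodes \<Delta> X = NL ` labs \<Delta> \<union> NX ` X
     \<union> {NT w t | w t. w \<in> ops \<Delta> \<and> t \<in> arity \<Delta> w \<rightarrow>\<^sub>E X}
     \<union> {ND w t i | w t i. w \<in> ops \<Delta> \<and> t \<in> arity \<Delta> w \<rightarrow>\<^sub>E X \<and> i \<in> arity \<Delta> w}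
     \<union> {NU d n | d n. is_lim \<Delta> d} \<union> {NV d n | d n. is_lim \<Delta> d}"

text \<open>\<open>NU d 0\<close> has a sort of its own: it starts the induction that identifies the
  ladder path of \<open>d\<close>.\<close>

fun node_sort :: "'u node \<Rightarrow> nat" where
  "node_sort (NL l) = 0"
| "node_sort (NX x) = 1"
| "node_sort (NT w t) = 2"
| "node_sort (ND w t i) = 3"
| "node_sort (NU d n) = (if n = 0 then 4 else 5)"
| "node_sort (NV d n) = 6"

fun node_label :: "'u alg_type \<Rightarrow> 'u node \<Rightarrow> 'u lab" where
  "node_label \<Delta> (NL l) = l"
| "node_label \<Delta> (NX x) = LX"
| "node_label \<Delta> (NT w t) = LT w"
| "node_label \<Delta> (ND w t i) = LD w i"
| "node_label \<Delta> (NU d n) = d"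
| "node_label \<Delta> (NV d n) = ladder \<Delta> d n"

text \<open>The second and third equations give the arcs from the sort mark to \<open>z\<close> and
  from \<open>z\<close> to its label. The first closes the 3-cycle, as the label is below the
  mark.\<close>

fun arc :: "'u alg_type \<Rightarrow> 'u algebra \<Rightarrow> 'u node \<Rightarrow> 'u node \<Rightarrow> bool" where
  "arc \<Delta> A (NL l) (NL l') \<longleftrightarrow> llt l l'"
| "arc \<Delta> A (NL l) z \<longleftrightarrow> l = Mark (node_sort z)"
| "arc \<Delta> A z (NL l) \<longleftrightarrow> l = node_label \<Delta> z"
| "arc \<Delta> A (NX x) (ND w t i) \<longleftrightarrow> x = t i"
| "arc \<Delta> A (ND w t i) (NT w' t') \<longleftrightarrow> w' = w \<and> t' = t"
| "arc \<Delta> A (NT w t) (NX x) \<longleftrightarrow> x = oper A w t"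
| "arc \<Delta> A (NU d n) (NV d' n') \<longleftrightarrow> d' = d \<and> n' = n"
| "arc \<Delta> A (NV d n) (NU d' n') \<longleftrightarrow> d' = d \<and> n' = Suc n"
| "arc \<Delta> A _ _ \<longleftrightarrow> False"

definition arcs :: "'u alg_type \<Rightarrow> 'u algebra \<Rightarrow> ('u node \<times> 'u node) set" where
  "arcs \<Delta> A = {(a, b). a \<in> nodes \<Delta> (carrier A) \<and> b \<in> nodes \<Delta> (carrier A) \<and> arc \<Delta> A a b}"

fun lift :: "'u alg_type \<Rightarrow> ('u \<Rightarrow> 'u) \<Rightarrow> 'u node \<Rightarrow> 'u node" where
  "lift \<Delta> h (NL l) = NL l"
| "lift \<Delta> h (NX x) = NX (h x)"
| "lift \<Delta> h (NT w t) = NT w (\<lambda>i\<in>arity \<Delta> w. h (t i))"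
| "lift \<Delta> h (ND w t i) = ND w (\<lambda>i\<in>arity \<Delta> w. h (t i)) i"
| "lift \<Delta> h (NU d n) = NU d n"
| "lift \<Delta> h (NV d n) = NV d n"

section \<open>Limits, nodes and triangles\<close>

lemma nodes_simps [simp]:
  "NL l \<in> nodes \<Delta> X \<longleftrightarrow> l \<in> labs \<Delta>"
  "NX x \<in> nodes \<Delta> X \<longleftrightarrow> x \<in> X"
  "NT w t \<in> nodes \<Delta> X \<longleftrightarrow> w \<in> ops \<Delta> \<and> t \<in> arity \<Delta> w \<rightarrow>\<^sub>E X"
  "ND w t i \<in> nodes \<Delta> X \<longleftrightarrow> w \<in> ops \<Delta> \<and> t \<in> arity \<Delta> w \<rightarrow>\<^sub>E X \<and> i \<in> arity \<Delta> w"
  "NU d n \<in> nodes \<Delta> X \<longleftrightarrow> is_lim \<Delta> d"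
  "NV d n \<in> nodes \<Delta> X \<longleftrightarrow> is_lim \<Delta> d"
  by (auto simp: nodes_def)

lemma labs_simps [simp]:
  "LX \<in> labs \<Delta>" "LT w \<in> labs \<Delta> \<longleftrightarrow> w \<in> ops \<Delta>" "LD w i \<in> labs \<Delta> \<longleftrightarrow> w \<in> ops \<Delta> \<and> i \<in> arity \<Delta> w"
  "Mark k \<in> labs \<Delta> \<longleftrightarrow> k \<le> 6"
  by (auto simp: labs_def)

lemma omega_limit_ladder: "omega_limit llt (labs \<Delta>) d s \<Longrightarrow> omega_limit llt (labs \<Delta>) d (ladder \<Delta> d)"
  unfolding ladder_def by (rule someI[where P = "omega_limit llt (labs \<Delta>) d"])

lemma ladder_omega_limit: "is_lim \<Delta> d \<Longrightarrow> omega_limit llt (labs \<Delta>) d (ladder \<Delta> d)"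
  using omega_limit_ladder by (auto simp: is_lim_def)

text \<open>Every mark after \<open>Mark 0\<close> has an immediate predecessor and so is no limit.
  Hence limits and their rungs lie below all marks that name sorts.\<close>

lemma is_limD:
  assumes "is_lim \<Delta> d"
  shows "d \<in> labs \<Delta>" "ladder \<Delta> d n \<in> labs \<Delta>" "llt (ladder \<Delta> d n) d" "lrank d \<le> 1" "lrank (ladder \<Delta> d n) \<le> 1"
    "ladder \<Delta> d n \<noteq> d"
proof -
  note l = ladder_omega_limit[OF assms, unfolded omega_limit_def]
  show d: "d \<in> labs \<Delta>" "ladder \<Delta> d n \<in> labs \<Delta>" "llt (ladder \<Delta> d n) d" using l by auto
  show ld: "lrank d \<le> 1"
  proof (rule ccontr)
    assume "\<not> ?thesis"
    then obtain k where k: "d = Mark (Suc k)" by (cases d) (auto simp: Suc_le_eq gr0_conv_Suc)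
    then have "Mark k \<in> labs \<Delta>" "llt (Mark k) d" using d by auto
    then obtain n where "llt (Mark k) (ladder \<Delta> d n)" using l by blast
    moreover have "llt (ladder \<Delta> d n) (Mark (Suc k))" using l k by blast
    ultimately show False by simp
  qed
  show "lrank (ladder \<Delta> d n) \<le> 1" using d(3) ld by (auto simp: llt_def)
  show "ladder \<Delta> d n \<noteq> d" using d(3) by auto
qed

lemma node_label_bounds:
  assumes "z \<in> nodes \<Delta> X" "node_sort z \<noteq> 0"
  shows "lrank (node_label \<Delta> z) \<le> 1" "node_label \<Delta> z \<in> labs \<Delta>" "node_sort z \<le> 6"
  using assms is_limD[where \<Delta> = \<Delta>] by (cases z; auto)+

text \<open>A node outside the labels has at most one label before it, its sort mark, and one after
  it, which is smaller; so a triangle with two labels is cyclic. Adjacent nodes outside the labels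
  differ in sort and in label, and no label of a node names a sort, which excludes triangles with
  one label. The remaining arcs form no transitive triangle.\<close>

lemma transitive_triangle:
  assumes "(a, b) \<in> arcs \<Delta> A" "(b, c) \<in> arcs \<Delta> A" "(a, c) \<in> arcs \<Delta> A"
  shows "a \<in> range NL" "b \<in> range NL" "c \<in> range NL"
proof -
  have n: "a \<in> nodes \<Delta> (carrier A)" "b \<in> nodes \<Delta> (carrier A)" "c \<in> nodes \<Delta> (carrier A)"
    "arc \<Delta> A a b" "arc \<Delta> A b c" "arc \<Delta> A a c"
    using assms by (auto simp: arcs_def)
  have bd: "\<not> k < lrank d" "\<not> k < lrank (ladder \<Delta> d m)" "ladder \<Delta> d m \<noteq> Mark k" "Mark k \<noteq> ladder \<Delta> d m"
    if "is_lim \<Delta> d" "1 \<le> k" for d k m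
  proof -
    have "lrank d \<le> 1" "lrank (ladder \<Delta> d m) \<le> 1" using is_limD(4,5)[OF that(1)] by auto
    then show "\<not> k < lrank d" "\<not> k < lrank (ladder \<Delta> d m)" "ladder \<Delta> d m \<noteq> Mark k" "Mark k \<noteq> ladder \<Delta> d m"
      using that(2) by (auto simp: eq_commute[of "Mark k"] dest!: arg_cong[of _ _ lrank])
  qed
  have ne: "ladder \<Delta> d m \<noteq> d" "d \<noteq> ladder \<Delta> d m" if "is_lim \<Delta> d" for d m
    using is_limD(6)[OF that] by metis+
  have nl: "\<not> is_lim \<Delta> (Mark k)" if "1 \<le> k" for k
    using is_limD(4)[of \<Delta> "Mark k"] that by auto
  have "a \<in> range NL \<and> b \<in> range NL \<and> c \<in> range NL"
    using n by (cases a; cases b; cases c) (auto simp: bd ne nl split: if_splits)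
  then show "a \<in> range NL" "b \<in> range NL" "c \<in> range NL" by auto
qed

text \<open>The marks 5 and 6 complete every smaller label to a triangle. As homomorphisms preserve
  transitive triangles, they send labels to labels.\<close>

lemma label_in_triangle:
  assumes "l \<in> labs \<Delta>"
  obtains a b c where "(a, b) \<in> arcs \<Delta> A" "(b, c) \<in> arcs \<Delta> A" "(a, c) \<in> arcs \<Delta> A" "NL l \<in> {a, b, c}"
proof (cases "llt l (Mark 5)")
  case True
  then show ?thesis using assms
    by (intro that[of "NL l" "NL (Mark 5)" "NL (Mark 6)"]) (auto simp: arcs_def)
next
  case False
  then have "l = Mark 5 \<or> l = Mark 6" using assms by (cases l) auto
  then show ?thesis
    by (intro that[of "NL (Mark 0)" "NL (Mark 5)" "NL (Mark 6)"]) (auto simp: arcs_def)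
qed

text \<open>On labels \<phi> acts by an increasing map \<open>f\<close>. It fixes the marks, so the
  3-cycles transfer sorts, and labels up to \<open>f\<close>. Then ladder paths go to ladder paths,
  and \<open>ladder_rigid\<close> makes \<open>f\<close> the identity.\<close>

lemma arc_hom_label:
  assumes \<phi>: "\<And>a. a \<in> nodes \<Delta> (carrier A) \<Longrightarrow> \<phi> a \<in> nodes \<Delta> (carrier B)"
    and arc: "\<And>a b. (a, b) \<in> arcs \<Delta> A \<Longrightarrow> (\<phi> a, \<phi> b) \<in> arcs \<Delta> B"
  shows "l \<in> labs \<Delta> \<Longrightarrow> \<phi> (NL l) = NL l"
    and "\<And>z. \<lbrakk>z \<in> nodes \<Delta> (carrier A); node_sort z \<noteq> 0\<rbrakk> \<Longrightarrow> node_sort (\<phi> z) = node_sort z \<and> node_label \<Delta> (\<phi> z) = node_label \<Delta> z"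
    and "is_lim \<Delta> d \<Longrightarrow> \<phi> (NU d n) = NU d n \<and> \<phi> (NV d n) = NV d n"
proof -
  have "\<exists>l'. \<phi> (NL l) = NL l'" if l: "l \<in> labs \<Delta>" for l
  proof -
    obtain a b c where abc: "(a, b) \<in> arcs \<Delta> A" "(b, c) \<in> arcs \<Delta> A" "(a, c) \<in> arcs \<Delta> A" "NL l \<in> {a, b, c}"
      using label_in_triangle[OF l] by blast
    show ?thesis
      using transitive_triangle[OF arc[OF abc(1)] arc[OF abc(2)] arc[OF abc(3)]] abc(4) by auto
  qed
  then obtain f where f: "\<And>l. l \<in> labs \<Delta> \<Longrightarrow> \<phi> (NL l) = NL (f l)" by metis
  have fL: "f l \<in> labs \<Delta>" if "l \<in> labs \<Delta>" for l
    using \<phi>[of "NL l"] f[OF that] that by simp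
  have mono: "llt (f l) (f l')" if "l \<in> labs \<Delta>" "l' \<in> labs \<Delta>" "llt l l'" for l l'
    using arc[of "NL l" "NL l'"] f that by (simp add: arcs_def)
  have ge: "\<not> llt (f l) l" if "l \<in> labs \<Delta>" for l
    using wfp_llt that
  proof (induction l rule: wfp_induct_rule)
    case (less l)
    then show ?case using mono fL by blast
  qed
  have top: "x = Mark 6 \<or> llt x (Mark 6)" if "x \<in> labs \<Delta>" for x
    using that by (cases x) auto
  \<comment> \<open>Downward from the greatest mark: the image of a mark is below the next mark,
    which is fixed, and not below the mark itself.\<close>
  have "k \<le> 6 \<Longrightarrow> f (Mark (6 - k)) = Mark (6 - k)" for k
  proof (induction k)
    case 0
    then show ?case using top[OF fL, of "Mark 6"] ge[of "Mark 6"] by simp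
  next
    case (Suc k)
    then have "llt (f (Mark (6 - Suc k))) (Mark (6 - k))"
      using mono[of "Mark (6 - Suc k)" "Mark (6 - k)"] by simp
    moreover have "\<not> llt (f (Mark (6 - Suc k))) (Mark (6 - Suc k))" by (rule ge) simp
    ultimately have "lrank (f (Mark (6 - Suc k))) = Suc (6 - Suc k)" using Suc.prems by simp
    then show ?case by (cases "f (Mark (6 - Suc k))") auto
  qed
  then have fM: "f (Mark k) = Mark k" if "k \<le> 6" for k
    using that by (metis diff_diff_cancel diff_le_self)
  have z: "node_sort (\<phi> z) = node_sort z \<and> node_label \<Delta> (\<phi> z) = f (node_label \<Delta> z)" if z: "z \<in> nodes \<Delta> (carrier A)" "node_sort z \<noteq> 0" for z
  proof -
    note o = node_label_bounds[OF z]
    have "(NL (Mark (node_sort z)), z) \<in> arcs \<Delta> A" "(z, NL (node_label \<Delta> z)) \<in> arcs \<Delta> A"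
      using z o by (cases z; simp add: arcs_def)+
    from this[THEN arc] have a: "arc \<Delta> B (NL (Mark (node_sort z))) (\<phi> z)" "arc \<Delta> B (\<phi> z) (NL (f (node_label \<Delta> z)))"
      using f fM o by (auto simp: arcs_def)
    have "llt (node_label \<Delta> z) (Mark (node_sort z))" using o z(2) by simp
    then have lt: "llt (f (node_label \<Delta> z)) (Mark (node_sort z))" using mono[of "node_label \<Delta> z" "Mark (node_sort z)"] o fM by simp
    show ?thesis
    proof (cases "\<phi> z")
      \<comment> \<open>If the image were a label, the 3-cycle would become a cycle of strict
        inequalities.\<close>
      case (NL r)
      then have "llt (Mark (node_sort z)) r" "llt r (f (node_label \<Delta> z))" using a by (simp_all only: arc.simps)
      then have "llt (Mark (node_sort z)) (f (node_label \<Delta> z))" by (rule llt_trans)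
      then show ?thesis using lt llt_trans llt_irrefl by blast
    qed (use a in auto)
  qed
  have UV: "\<phi> (NU d n) = NU (f d) n \<and> \<phi> (NV d n) = NV (f d) n" if d: "is_lim \<Delta> d" for d n
  proof -
    have V: "\<phi> (NV d n) = NV (f d) n" if "\<phi> (NU d n) = NU (f d) n" for n
    proof -
      have "(NU d n, NV d n) \<in> arcs \<Delta> A" using d by (simp add: arcs_def)
      from arc[OF this] have "arc \<Delta> B (NU (f d) n) (\<phi> (NV d n))" using that by (simp add: arcs_def)
      then show ?thesis using z[of "NV d n"] d by (cases "\<phi> (NV d n)") auto
    qed
    \<comment> \<open>Sort 4 belongs to \<open>NU _ 0\<close> only, so the path of \<open>d\<close>
      starts at the start of the path of \<open>f d\<close>; the arcs then carry the index
      along.\<close>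
    have "\<phi> (NU d n) = NU (f d) n"
    proof (induction n)
      case 0
      show ?case using z[of "NU d 0"] d by (cases "\<phi> (NU d 0)") (auto split: if_splits)
    next
      case (Suc n)
      have "(NV d n, NU d (Suc n)) \<in> arcs \<Delta> A" using d by (simp add: arcs_def)
      from arc[OF this] have "arc \<Delta> B (NV (f d) n) (\<phi> (NU d (Suc n)))" using V[OF Suc] by (simp add: arcs_def)
      then show ?case using z[of "NU d (Suc n)"] d by (cases "\<phi> (NU d (Suc n))") auto
    qed
    then show ?thesis using V by blast
  qed
  have fid: "f l = l" if "l \<in> labs \<Delta>" for l
  proof (rule ladder_rigid[OF wfp_llt transp_llt totalp_llt fL mono _ top omega_limit_ladder _ that])
    show "Mark 6 \<in> labs \<Delta>" by simp
    fix d n assume "omega_limit llt (labs \<Delta>) d (ladder \<Delta> d)"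
    then have d: "is_lim \<Delta> d" by (auto simp: is_lim_def)
    have "NV (f d) n \<in> nodes \<Delta> (carrier B)" using \<phi>[of "NV d n"] UV[OF d] d by auto
    then have "is_lim \<Delta> (f d)" by simp
    \<comment> \<open>The label of \<open>NV d n\<close> is the rung itself, so transfer of labels
      means that \<open>f\<close> commutes with ladders.\<close>
    moreover have "f (ladder \<Delta> d n) = ladder \<Delta> (f d) n"
      using z[of "NV d n"] d UV[OF d, of n] by simp
    ultimately show "omega_limit llt (labs \<Delta>) (f d) (ladder \<Delta> (f d)) \<and> f (ladder \<Delta> d n) = ladder \<Delta> (f d) n"
      using ladder_omega_limit by blast
  qed
  show "\<phi> (NL l) = NL l" if "l \<in> labs \<Delta>" using f fid that by simp
  show "node_sort (\<phi> z) = node_sort z \<and> node_label \<Delta> (\<phi> z) = node_label \<Delta> z" if "z \<in> nodes \<Delta> (carrier A)" "node_sort z \<noteq> 0" for z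
    using z[OF that] fid node_label_bounds(2)[OF that] by simp
  show "\<phi> (NU d n) = NU d n \<and> \<phi> (NV d n) = NV d n" if "is_lim \<Delta> d"
    using UV[OF that] fid is_limD(1)[OF that] by simp
qed

lemma oper_closed:
  assumes A: "is_algebra \<Delta> A" and w: "w \<in> ops \<Delta>" and t: "t \<in> arity \<Delta> w \<rightarrow>\<^sub>E carrier A"
  shows "oper A w t \<in> carrier A"
proof -
  have "oper A w \<in> (arity \<Delta> w \<rightarrow>\<^sub>E carrier A) \<rightarrow>\<^sub>E carrier A"
    using A w unfolding is_algebra_def by (rule PiE_mem)
  then show ?thesis using t by (rule PiE_mem)
qed

text \<open>The elements form one sort, on which \<phi> acts as \<open>h\<close>. The coordinates
  force the image of \<open>(w, t)\<close> to be the family of the \<open>h (t i)\<close>, and the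
  arc to the value of the operation then says that \<open>h\<close> is a homomorphism.\<close>

lemma arc_hom_is_lift:
  assumes A: "is_algebra \<Delta> A"
    and \<phi>: "\<And>a. a \<in> nodes \<Delta> (carrier A) \<Longrightarrow> \<phi> a \<in> nodes \<Delta> (carrier B)"
    and arc: "\<And>a b. (a, b) \<in> arcs \<Delta> A \<Longrightarrow> (\<phi> a, \<phi> b) \<in> arcs \<Delta> B"
  obtains h where "h \<in> algebra_hom \<Delta> A B" "\<And>v. v \<in> nodes \<Delta> (carrier A) \<Longrightarrow> \<phi> v = lift \<Delta> h v"
proof -
  note lab = arc_hom_label[where \<phi> = \<phi> and \<Delta> = \<Delta> and A = A and B = B, OF \<phi> arc]
  have "\<exists>x'\<in>carrier B. \<phi> (NX x) = NX x'" if "x \<in> carrier A" for x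
    using lab(2)[where z = "NX x"] \<phi>[of "NX x"] that by (cases "\<phi> (NX x)") (auto split: if_splits)
  then obtain h' where h': "\<And>x. x \<in> carrier A \<Longrightarrow> h' x \<in> carrier B \<and> \<phi> (NX x) = NX (h' x)" by metis
  define h where "h = restrict h' (carrier A)"
  have hB: "h \<in> carrier A \<rightarrow>\<^sub>E carrier B" and hX: "\<And>x. x \<in> carrier A \<Longrightarrow> \<phi> (NX x) = NX (h x)"
    using h' by (auto simp: h_def)
  note op = oper_closed[OF A]
  have T: "\<phi> (NT w t) = NT w (\<lambda>i\<in>arity \<Delta> w. h (t i))"
    and D: "i \<in> arity \<Delta> w \<Longrightarrow> \<phi> (ND w t i) = ND w (\<lambda>i\<in>arity \<Delta> w. h (t i)) i"
    if wt: "w \<in> ops \<Delta>" "t \<in> arity \<Delta> w \<rightarrow>\<^sub>E carrier A" for w t i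
  proof -
    obtain t' where t': "\<phi> (NT w t) = NT w t'" "t' \<in> arity \<Delta> w \<rightarrow>\<^sub>E carrier B"
      using lab(2)[where z = "NT w t"] \<phi>[of "NT w t"] wt by (cases "\<phi> (NT w t)") (auto split: if_splits)
    \<comment> \<open>The label keeps \<open>w\<close> and \<open>i\<close>, the arc to
      \<open>NT w t'\<close> yields the family \<open>t'\<close>, and the arc from the element
      \<open>h (t i)\<close> yields its value at \<open>i\<close>.\<close>
    have D': "\<phi> (ND w t i) = ND w t' i \<and> t' i = h (t i)" if i: "i \<in> arity \<Delta> w" for i
    proof -
      have ti: "t i \<in> carrier A" using wt i by auto
      have "(ND w t i, NT w t) \<in> arcs \<Delta> A" "(NX (t i), ND w t i) \<in> arcs \<Delta> A"
        using wt i ti by (auto simp: arcs_def)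
      from this[THEN arc] have "arc \<Delta> B (\<phi> (ND w t i)) (NT w t')" "arc \<Delta> B (NX (h (t i))) (\<phi> (ND w t i))"
        using t' hX[OF ti] by (auto simp: arcs_def)
      then show ?thesis using lab(2)[where z = "ND w t i"] wt i
        by (cases "\<phi> (ND w t i)") (auto split: if_splits)
    qed
    have "t' = (\<lambda>i\<in>arity \<Delta> w. h (t i))"
      using D' t'(2) by (auto simp: PiE_iff extensional_def fun_eq_iff)
    then show "\<phi> (NT w t) = NT w (\<lambda>i\<in>arity \<Delta> w. h (t i))"
      "i \<in> arity \<Delta> w \<Longrightarrow> \<phi> (ND w t i) = ND w (\<lambda>i\<in>arity \<Delta> w. h (t i)) i"
      using t' D' by auto
  qed
  show thesis
  proof (rule that)
    have "h (oper A w t) = oper B w (\<lambda>i\<in>arity \<Delta> w. h (t i))"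
      if wt: "w \<in> ops \<Delta>" "t \<in> arity \<Delta> w \<rightarrow>\<^sub>E carrier A" for w t
    proof -
      have "(NT w t, NX (oper A w t)) \<in> arcs \<Delta> A" using wt op[OF wt] by (simp add: arcs_def)
      from arc[OF this] show ?thesis using T[OF wt] hX[OF op[OF wt]] by (simp add: arcs_def)
    qed
    then show "h \<in> algebra_hom \<Delta> A B" using hB by (auto simp: algebra_hom_def)
    show "\<phi> v = lift \<Delta> h v" if "v \<in> nodes \<Delta> (carrier A)" for v
      using that lab(1,3) T D hX by (cases v) auto
  qed
qed

section \<open>Algebra homomorphisms acting on the digraphs\<close>

lemma lift_node:
  assumes "h \<in> carrier A \<rightarrow> carrier B" "v \<in> nodes \<Delta> (carrier A)"
  shows "lift \<Delta> h v \<in> nodes \<Delta> (carrier B)"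
  using assms by (cases v) (auto simp: PiE_iff)

text \<open>Compatibility with the operations enters at the arcs from \<open>NT w t\<close> to the
  value; the other arcs are respected by any map of carriers.\<close>

lemma lift_arc:
  assumes h: "h \<in> algebra_hom \<Delta> A B" and ab: "(a, b) \<in> arcs \<Delta> A"
  shows "(lift \<Delta> h a, lift \<Delta> h b) \<in> arcs \<Delta> B"
proof -
  have hB: "h \<in> carrier A \<rightarrow> carrier B" using h by (auto simp: algebra_hom_def)
  have "arc \<Delta> B (lift \<Delta> h a) (lift \<Delta> h b)"
    using ab h by (cases a; cases b) (auto simp: arcs_def algebra_hom_def)
  then show ?thesis using ab lift_node[OF hB] by (auto simp: arcs_def)
qed

lemma lift_id: "v \<in> nodes \<Delta> X \<Longrightarrow> lift \<Delta> (\<lambda>x\<in>X. x) v = v"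
  by (cases v) (auto simp: PiE_iff extensional_def fun_eq_iff)

lemma lift_compose:
  assumes "v \<in> nodes \<Delta> X"
  shows "lift \<Delta> (compose X g f) v = lift \<Delta> g (lift \<Delta> f v)"
  using assms by (cases v) (auto simp: PiE_iff compose_def fun_eq_iff restrict_def)

lemma arcs_determine_algebra:
  assumes "is_algebra \<Delta> A" "is_algebra \<Delta> B" "carrier A = carrier B" "arcs \<Delta> A = arcs \<Delta> B"
  shows "A = B"
proof -
  note op = oper_closed[OF assms(1)]
  have "oper A w t = oper B w t" if wt: "w \<in> ops \<Delta>" "t \<in> arity \<Delta> w \<rightarrow>\<^sub>E carrier A" for w t
  proof -
    have "(NT w t, NX (oper A w t)) \<in> arcs \<Delta> A" using wt op[OF wt] by (simp add: arcs_def)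
    then show ?thesis unfolding assms(4) by (simp add: arcs_def)
  qed
  then have eq: "oper A w t = oper B w t" if "w \<in> ops \<Delta>" "t \<in> arity \<Delta> w \<rightarrow>\<^sub>E carrier A" for w t
    using that by blast
  have "oper A = oper B"
  proof (rule PiE_ext)
    show AB: "oper A \<in> (\<Pi>\<^sub>E w\<in>ops \<Delta>. (arity \<Delta> w \<rightarrow>\<^sub>E carrier A) \<rightarrow>\<^sub>E carrier A)"
      "oper B \<in> (\<Pi>\<^sub>E w\<in>ops \<Delta>. (arity \<Delta> w \<rightarrow>\<^sub>E carrier A) \<rightarrow>\<^sub>E carrier A)"
      using assms(1-3) by (simp_all add: is_algebra_def)
    fix w assume w: "w \<in> ops \<Delta>"
    show "oper A w = oper B w"
    proof (rule PiE_ext)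
      show "oper A w \<in> (arity \<Delta> w \<rightarrow>\<^sub>E carrier A) \<rightarrow>\<^sub>E carrier A"
        "oper B w \<in> (arity \<Delta> w \<rightarrow>\<^sub>E carrier A) \<rightarrow>\<^sub>E carrier A"
        using AB[THEN PiE_mem, OF w] by blast+
    qed (rule eq[OF w])
  qed
  then show ?thesis using assms(3) by (simp add: algebra.equality)
qed

section \<open>Sizes\<close>

text \<open>Unlike membership in \<open>U\<close>, this applies to sets over any type.\<close>

definition small :: "'u set set \<Rightarrow> 'a set \<Rightarrow> bool" where
  "small U S \<longleftrightarrow> (\<exists>Y\<in>U. S \<lesssim> Y)"

lemma lepoll_iff_ordLeq: "A \<lesssim> B \<longleftrightarrow> ordLeq3 (card_of A) (card_of B)"
  unfolding lepoll_def card_of_ordLeq[symmetric] ..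

lemma small_mem: "X \<in> U \<Longrightarrow> small U X"
  unfolding small_def by (blast intro: lepoll_refl)

lemma small_lepoll: "\<lbrakk>small U T; S \<lesssim> T\<rbrakk> \<Longrightarrow> small U S"
  unfolding small_def by (meson lepoll_trans)

lemma small_subset: "\<lbrakk>small U T; S \<subseteq> T\<rbrakk> \<Longrightarrow> small U S"
  by (rule small_lepoll[OF _ subset_imp_lepoll])

lemma small_image: "small U S \<Longrightarrow> small U (f ` S)"
  by (rule small_lepoll[OF _ image_lepoll])

lemma lepoll_linear: "A \<lesssim> B \<or> B \<lesssim> A"
  unfolding lepoll_iff_ordLeq by (rule ordLeq_total) (rule card_of_Well_order)+

text \<open>Cardinals are comparable, so the largest of the two bounds and an infinite member of
  \<open>U\<close> serves for both sets.\<close>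

lemma small_common_bound:
  assumes U: "set_universe U" and S: "small U S" and T: "small U T"
  obtains Z where "Z \<in> U" "infinite Z" "S \<lesssim> Z" "T \<lesssim> Z"
proof -
  obtain Q where Q: "Q \<in> U" "infinite Q" using U by (auto simp: set_universe_def)
  have *: "\<exists>Z\<in>U. infinite Z \<and> Y \<lesssim> Z \<and> Y' \<lesssim> Z" if "Y' \<in> U" "infinite Y'" "Y \<in> U" for Y Y'
  proof (cases "Y \<lesssim> Y'")
    case True then show ?thesis using that by blast
  next
    case False
    then have "Y' \<lesssim> Y" using lepoll_linear by blast
    moreover have "infinite Y" using that(2) \<open>Y' \<lesssim> Y\<close> lepoll_trans infinite_le_lepoll by blast
    ultimately show ?thesis using that by blast
  qed
  obtain Y1 Y2 where Y: "Y1 \<in> U" "S \<lesssim> Y1" "Y2 \<in> U" "T \<lesssim> Y2" using S T by (auto simp: small_def)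
  obtain Z1 where Z1: "Z1 \<in> U" "infinite Z1" "Y1 \<lesssim> Z1" using *[OF Q Y(1)] by blast
  obtain Z where "Z \<in> U" "infinite Z" "Y2 \<lesssim> Z" "Z1 \<lesssim> Z" using *[OF Z1(1,2) Y(3)] by blast
  then show thesis using that Z1 Y lepoll_trans by metis
qed

lemma Un_lepoll_infinite: "\<lbrakk>infinite Z; S \<lesssim> Z; T \<lesssim> Z\<rbrakk> \<Longrightarrow> S \<union> T \<lesssim> Z"
  unfolding lepoll_iff_ordLeq
  by (rule card_of_Un_ordLeq_infinite_Field) (simp_all add: Field_card_of card_of_card_order_on)

lemma Times_lepoll_infinite: "\<lbrakk>infinite Z; S \<lesssim> Z; T \<lesssim> Z\<rbrakk> \<Longrightarrow> S \<times> T \<lesssim> Z"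
  unfolding lepoll_iff_ordLeq
  by (rule card_of_Times_ordLeq_infinite_Field) (simp_all add: Field_card_of card_of_card_order_on)

lemma small_Un: "\<lbrakk>set_universe U; small U S; small U T\<rbrakk> \<Longrightarrow> small U (S \<union> T)"
  by (erule (2) small_common_bound) (auto simp: small_def intro: Un_lepoll_infinite)

lemma small_Times: "\<lbrakk>set_universe U; small U S; small U T\<rbrakk> \<Longrightarrow> small U (S \<times> T)"
  by (erule (2) small_common_bound) (auto simp: small_def intro: Times_lepoll_infinite)

lemma small_countable: "set_universe U \<Longrightarrow> small U (UNIV :: nat set)"
  unfolding set_universe_def small_def using infinite_le_lepoll by blast

lemma small_args:
  assumes "type_in_universe U \<Delta>" "X \<in> U"
  shows "small U (SIGMA w:ops \<Delta>. arity \<Delta> w \<rightarrow>\<^sub>E X)"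
  using assms by (auto simp: type_in_universe_def small_def)

text \<open>Maps into a two-element set distinguish the operations and the elements of the arities.\<close>

lemma small_ops:
  assumes U: "set_universe U" and \<Delta>: "type_in_universe U \<Delta>"
  shows "small U (ops \<Delta>)" "small U (SIGMA w:ops \<Delta>. arity \<Delta> w)"
proof -
  obtain Q where Q: "Q \<in> U" "infinite Q" using U by (auto simp: set_universe_def)
  then obtain a where a: "a \<in> Q" using infinite_imp_nonempty by blast
  obtain b where b: "b \<in> Q" "b \<noteq> a" using Q infinite_remove[of Q a] infinite_imp_nonempty by blast
  have "{a, b} \<lesssim> Q" using a b by (intro subset_imp_lepoll) auto
  then have "{a, b} \<in> U" using U Q(1) unfolding set_universe_def by blast
  note S = small_args[OF \<Delta> this]
  let ?S = "SIGMA w:ops \<Delta>. arity \<Delta> w \<rightarrow>\<^sub>E {a, b}"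
  have "ops \<Delta> \<subseteq> fst ` ?S"
  proof
    fix w assume "w \<in> ops \<Delta>"
    then have "(w, \<lambda>i\<in>arity \<Delta> w. a) \<in> ?S" by auto
    then show "w \<in> fst ` ?S" by (rule image_eqI[rotated]) simp
  qed
  then show "small U (ops \<Delta>)" using small_subset[OF small_image[OF S]] by blast
  let ?f = "\<lambda>(w, i). (w, \<lambda>j\<in>arity \<Delta> w. if j = i then b else a)"
  have "inj_on ?f (SIGMA w:ops \<Delta>. arity \<Delta> w)"
  proof (rule inj_onI)
    fix p q
    assume pq: "p \<in> (SIGMA w:ops \<Delta>. arity \<Delta> w)" "q \<in> (SIGMA w:ops \<Delta>. arity \<Delta> w)" "?f p = ?f q"
    obtain w i i' where p: "p = (w, i)" "q = (w, i')" using pq(3) by (cases p; cases q) auto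
    then have "(\<lambda>j\<in>arity \<Delta> w. if j = i then b else a) = (\<lambda>j\<in>arity \<Delta> w. if j = i' then b else a)"
      using pq(3) by simp
    from fun_cong[OF this, of i] show "p = q" using pq(1) b p by (auto split: if_splits)
  qed
  then have "(SIGMA w:ops \<Delta>. arity \<Delta> w) \<lesssim> ?S" unfolding lepoll_def by (intro exI[of _ ?f]) auto
  then show "small U (SIGMA w:ops \<Delta>. arity \<Delta> w)" by (rule small_lepoll[OF S])
qed

lemma small_nodes:
  assumes U: "set_universe U" and \<Delta>: "type_in_universe U \<Delta>" and X: "X \<in> U"
  shows "small U (nodes \<Delta> X)"
proof -
  let ?S = "SIGMA w:ops \<Delta>. arity \<Delta> w \<rightarrow>\<^sub>E X" and ?I = "SIGMA w:ops \<Delta>. arity \<Delta> w"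
  note Un = small_Un[OF U] and Tm = small_Times[OF U] and nat = small_countable[OF U]
  have fin: "small U S" if "finite S" for S :: "'b set"
    using U that finite_lepoll_infinite by (auto simp: set_universe_def small_def)
  have "labs \<Delta> = {LX} \<union> LT ` ops \<Delta> \<union> (\<lambda>(w, i). LD w i) ` ?I \<union> Mark ` {..6}"
    by (auto simp: labs_def)
  also have "small U \<dots>"
    using small_ops[OF U \<Delta>] by (intro Un small_image) (simp_all add: fin)
  finally have L: "small U (labs \<Delta>)" .
  have "nodes \<Delta> X \<subseteq> NL ` labs \<Delta> \<union> NX ` X \<union> (\<lambda>(w, t). NT w t) ` ?S
      \<union> (\<lambda>((w, t), (w', i)). ND w t i) ` (?S \<times> ?I)
      \<union> (\<lambda>(d, n). NU d n) ` (labs \<Delta> \<times> UNIV) \<union> (\<lambda>(d, n). NV d n) ` (labs \<Delta> \<times> UNIV)" (is "_ \<subseteq> ?R")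
    unfolding nodes_def using is_limD(1)[where \<Delta> = \<Delta>] by (auto simp: image_iff)
  moreover have "small U ?R"
    using small_ops[OF U \<Delta>] small_args[OF \<Delta> X] small_mem[OF X] L nat
    by (intro Un small_image Tm)
  ultimately show ?thesis using small_subset by blast
qed

text \<open>The complete digraph covers all algebras on one carrier at once.\<close>

lemma small_pverts:
  assumes U: "set_universe U" and N: "small U N"
  shows "small U (pverts k N (N \<times> N))"
proof -
  have "pverts k N (N \<times> N) \<subseteq> Base ` N \<union> (\<lambda>((a, b), i). Inner a b i) ` ((N \<times> N) \<times> UNIV)"
    unfolding pverts_def by force
  then show ?thesis
    using small_subset small_Un[OF U] small_image small_Times[OF U] small_countable[OF U] N by metis
qed

text \<open>
  The last condition makes the carrier of an algebra recoverable from the vertex set of its graph, as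
  required for a functor that is injective on objects.
\<close>

lemma encoding_exists:
  fixes U :: "'u set set"
  assumes U: "set_universe U"
  obtains j :: "'u \<Rightarrow> 'u" where
    "\<And>M \<iota> X. \<lbrakk>small U M; inj_on \<iota> X; \<iota> ` X \<subseteq> M\<rbrakk> \<Longrightarrow>
       \<exists>e. inj_on e M \<and> e ` M \<in> U \<and> (\<forall>x\<in>X. e (\<iota> x) = j x) \<and> {y. j y \<in> e ` M} = X"
proof -
  obtain Q where Q: "Q \<in> U" "infinite Q" using U by (auto simp: set_universe_def)
  have inf: "infinite (UNIV :: 'u set)" using infinite_super[OF subset_UNIV Q(2)] .
  have "(UNIV :: 'u set) \<times> (UNIV :: 'u set) \<lesssim> (UNIV :: 'u set)"
    by (rule Times_lepoll_infinite[OF inf]) auto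
  then obtain p :: "'u \<times> 'u \<Rightarrow> 'u" where p: "inj p" by (auto simp: lepoll_def)
  obtain c where "c \<in> Q" using Q(2) infinite_imp_nonempty by blast
  obtain d where "d \<in> Q - {c}" using infinite_remove[OF Q(2), of c] infinite_imp_nonempty by blast
  then have cd: "c \<noteq> d" by blast
  show thesis
  proof (rule that[of "\<lambda>x. p (x, c)"])
    fix M :: "'a set" and \<iota> :: "'u \<Rightarrow> 'a" and X
    assume M: "small U M" and \<iota>: "inj_on \<iota> X" "\<iota> ` X \<subseteq> M"
    obtain Y where Y: "Y \<in> U" "M \<lesssim> Y" using M by (auto simp: small_def)
    then obtain g :: "'a \<Rightarrow> 'u" where g: "inj_on g M" by (auto simp: lepoll_def)
    \<comment> \<open>Elements of \<open>X\<close> receive the tag \<open>c\<close> and all other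
      members the tag \<open>d\<close>, so \<open>X\<close> can be read off from the image.\<close>
    define e where "e v = (if v \<in> \<iota> ` X then p (inv_into X \<iota> v, c) else p (g v, d))" for v
    have "inj_on e M"
    proof (rule inj_onI)
      fix u v assume uv: "u \<in> M" "v \<in> M" "e u = e v"
      then consider "u \<in> \<iota> ` X" "v \<in> \<iota> ` X" "inv_into X \<iota> u = inv_into X \<iota> v"
        | "u \<notin> \<iota> ` X" "v \<notin> \<iota> ` X" "g u = g v"
        using cd by (auto simp: e_def inj_eq[OF p] split: if_splits)
      then show "u = v"
      proof cases
        case 1
        then show ?thesis using inv_into_injective[of X \<iota> u v] by blast
      next
        case 2
        then show ?thesis using inj_onD[OF g] uv by blast
      qed
    qed
    moreover have "e ` M \<in> U"
    proof -
      have "e ` M \<lesssim> Y" by (rule lepoll_trans[OF image_lepoll Y(2)])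
      then show ?thesis using U Y(1) by (simp add: set_universe_def)
    qed
    moreover have ex: "e (\<iota> x) = p (x, c)" if "x \<in> X" for x
      using that \<iota> by (simp add: e_def)
    moreover have "{y. p (y, c) \<in> e ` M} = X"
    proof (intro equalityI subsetI)
      fix y assume "y \<in> {y. p (y, c) \<in> e ` M}"
      then obtain v where v: "p (y, c) = e v" by auto
      have "v \<in> \<iota> ` X \<and> y = inv_into X \<iota> v"
        using v cd by (auto simp: e_def inj_eq[OF p] split: if_splits)
      then show "y \<in> X" using inv_into_into by metis
    next
      fix y assume y: "y \<in> X"
      then have "\<iota> y \<in> M" using \<iota>(2) by blast
      then show "y \<in> {y. p (y, c) \<in> e ` M}" using ex[OF y] by (metis imageI mem_Collect_eq)
    qed
    ultimately show "\<exists>e. inj_on e M \<and> e ` M \<in> U \<and> (\<forall>x\<in>X. e (\<iota> x) = p (x, c)) \<and> {y. p (y, c) \<in> e ` M} = X"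
      by blast
  qed
qed

section \<open>Full embeddings into slice categories of graphs\<close>

text \<open>Separates the combinatorics from the renaming of vertices. Graphs may live on any type,
  with maps not made extensional; the structure over \<open>G\<close> is a colouring, so morphisms
  of the slice are the colour-preserving homomorphisms.\<close>

lemma fully_embeds_slice_Gra:
  fixes C :: "('o, 'm) category" and U :: "'u set set" and e :: "'o \<Rightarrow> 'v \<Rightarrow> 'u"
    and V :: "'o \<Rightarrow> 'v set" and E :: "'o \<Rightarrow> 'v set set" and c :: "'v \<Rightarrow> 'u"
    and P :: "'o \<Rightarrow> 'o \<Rightarrow> 'm \<Rightarrow> 'v \<Rightarrow> 'v"
  assumes cat: "is_category C"
    and e: "\<And>a. a \<in> Obj C \<Longrightarrow> inj_on (e a) (V a)" "\<And>a. a \<in> Obj C \<Longrightarrow> e a ` V a \<in> U"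
    and obj: "inj_on (\<lambda>a. e a ` V a) (Obj C)"
    and E: "\<And>a d. a \<in> Obj C \<Longrightarrow> d \<in> E a \<Longrightarrow> d \<subseteq> V a" "\<And>a d. a \<in> Obj C \<Longrightarrow> d \<in> E a \<Longrightarrow> card d = 2"
    and c: "\<And>a v. a \<in> Obj C \<Longrightarrow> v \<in> V a \<Longrightarrow> c v \<in> verts G"
      "\<And>a x y. a \<in> Obj C \<Longrightarrow> {x, y} \<in> E a \<Longrightarrow> {c x, c y} \<in> edges G"
    and P: "\<And>a b f v. \<lbrakk>a \<in> Obj C; b \<in> Obj C; f \<in> Hom C a b; v \<in> V a\<rbrakk> \<Longrightarrow> P a b f v \<in> V b"
      "\<And>a b f x y. \<lbrakk>a \<in> Obj C; b \<in> Obj C; f \<in> Hom C a b; {x, y} \<in> E a\<rbrakk> \<Longrightarrow> {P a b f x, P a b f y} \<in> E b"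
      "\<And>a b f v. \<lbrakk>a \<in> Obj C; b \<in> Obj C; f \<in> Hom C a b; v \<in> V a\<rbrakk> \<Longrightarrow> c (P a b f v) = c v"
      "\<And>a v. \<lbrakk>a \<in> Obj C; v \<in> V a\<rbrakk> \<Longrightarrow> P a a (Ident C a) v = v"
      "\<And>a b d f g v. \<lbrakk>a \<in> Obj C; b \<in> Obj C; d \<in> Obj C; f \<in> Hom C a b; g \<in> Hom C b d; v \<in> V a\<rbrakk> \<Longrightarrow>
         P a d (Comp C a b d g f) v = P b d g (P a b f v)"
    and faithful: "\<And>a b f g. \<lbrakk>a \<in> Obj C; b \<in> Obj C; f \<in> Hom C a b; g \<in> Hom C a b;
         \<And>v. v \<in> V a \<Longrightarrow> P a b f v = P a b g v\<rbrakk> \<Longrightarrow> f = g"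
    and full: "\<And>a b \<psi>. \<lbrakk>a \<in> Obj C; b \<in> Obj C; \<And>v. v \<in> V a \<Longrightarrow> \<psi> v \<in> V b;
         \<And>x y. {x, y} \<in> E a \<Longrightarrow> {\<psi> x, \<psi> y} \<in> E b; \<And>v. v \<in> V a \<Longrightarrow> c (\<psi> v) = c v\<rbrakk> \<Longrightarrow>
         \<exists>f\<in>Hom C a b. \<forall>v\<in>V a. \<psi> v = P a b f v"
  shows "fully_embeds C (slice_category (Gra U) G)"
proof -
  define dec where "dec a = inv_into (V a) (e a)" for a
  have dec: "dec a (e a v) = v" if "a \<in> Obj C" "v \<in> V a" for a v
    unfolding dec_def using inv_into_f_f[OF e(1)] that by blast
  have decV: "dec a y \<in> V a" "e a (dec a y) = y" if "y \<in> e a ` V a" for a y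
    unfolding dec_def using that by (auto intro: inv_into_into f_inv_into_f)
  define gr where "gr a = \<lparr>verts = e a ` V a, edges = (\<lambda>d. e a ` d) ` E a\<rparr>" for a
  define col where "col a = (\<lambda>y\<in>e a ` V a. c (dec a y))" for a
  define Fm where "Fm a b f = (\<lambda>y\<in>e a ` V a. e b (P a b f (dec a y)))" for a b f
  have gr_simps [simp]: "verts (gr a) = e a ` V a" "edges (gr a) = (\<lambda>d. e a ` d) ` E a" for a
    by (simp_all add: gr_def)
  \<comment> \<open>As \<open>e a\<close> is injective, an encoded edge comes from an edge between
    the decoded ends.\<close>
  have edge: "\<exists>x\<in>V a. \<exists>y\<in>V a. x' = e a x \<and> y' = e a y \<and> {x, y} \<in> E a"
    if a: "a \<in> Obj C" and xy: "{x', y'} \<in> edges (gr a)" for a x' y'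
  proof -
    obtain d where d: "d \<in> E a" "e a ` d = {x', y'}" using xy by auto
    obtain x where x: "x \<in> d" "e a x = x'" using d(2) by (metis imageE insertI1)
    obtain y where y: "y \<in> d" "e a y = y'" using d(2) by (metis imageE insertI1 insert_commute)
    have dV: "d \<subseteq> V a" using E(1)[OF a d(1)] .
    have "z = x \<or> z = y" if "z \<in> d" for z
    proof -
      have "e a z \<in> {x', y'}" using d(2) that by blast
      then show ?thesis using inj_onD[OF e(1)[OF a]] x y dV that by blast
    qed
    then have "d = {x, y}" using x y by blast
    then show ?thesis using d x y dV by blast
  qed
  have grG: "is_graph (gr a)" if a: "a \<in> Obj C" for a
    unfolding is_graph_def
  proof
    fix d' assume "d' \<in> edges (gr a)"
    then obtain d where d: "d \<in> E a" "d' = e a ` d" by auto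
    have "card d' = card d"
      unfolding d(2) by (rule card_image) (rule inj_on_subset[OF e(1)[OF a] E(1)[OF a d(1)]])
    then show "d' \<subseteq> verts (gr a) \<and> card d' = 2" using E[OF a d(1)] d(2) by auto
  qed
  have homI: "(\<lambda>y\<in>e a ` V a. F (dec a y)) \<in> graph_hom (gr a) H"
    if a: "a \<in> Obj C" and F: "\<And>v. v \<in> V a \<Longrightarrow> F v \<in> verts H" "\<And>x y. {x, y} \<in> E a \<Longrightarrow> {F x, F y} \<in> edges H"
    for a and F :: "'v \<Rightarrow> 'u" and H
  proof -
    have "{(\<lambda>y\<in>e a ` V a. F (dec a y)) x', (\<lambda>y\<in>e a ` V a. F (dec a y)) y'} \<in> edges H"
      if "{x', y'} \<in> edges (gr a)" for x' y'
    proof -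
      obtain x y where "x \<in> V a" "y \<in> V a" "x' = e a x" "y' = e a y" "{x, y} \<in> E a"
        using edge[OF a \<open>{x', y'} \<in> edges (gr a)\<close>] by blast
      then show ?thesis using F(2)[of x y] by (simp add: dec[OF a])
    qed
    moreover have "(\<lambda>y\<in>e a ` V a. F (dec a y)) \<in> verts (gr a) \<rightarrow>\<^sub>E verts H"
      using F(1) dec[OF a] by auto
    ultimately show ?thesis by (simp add: graph_hom_def)
  qed
  have colG: "col a \<in> graph_hom (gr a) G" if "a \<in> Obj C" for a
    unfolding col_def by (rule homI) (use that c in auto)
  have FmG: "Fm a b f \<in> graph_hom (gr a) (gr b)" if ab: "a \<in> Obj C" "b \<in> Obj C" "f \<in> Hom C a b" for a b f
    unfolding Fm_def
  proof (rule homI[OF ab(1)])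
    show "e b (P a b f v) \<in> verts (gr b)" if "v \<in> V a" for v
      using P(1)[OF ab that] by simp
    show "{e b (P a b f x), e b (P a b f y)} \<in> edges (gr b)" if "{x, y} \<in> E a" for x y
      using imageI[OF P(2)[OF ab that], of "\<lambda>d. e b ` d"] by simp
  qed
  have Fm_e: "Fm a b f (e a v) = e b (P a b f v)" if "a \<in> Obj C" "v \<in> V a" for a b f v
    using that dec by (simp add: Fm_def)
  have col_e: "col a (e a v) = c v" if "a \<in> Obj C" "v \<in> V a" for a v
    using that dec by (simp add: col_def)
  have Fm_slice: "Fm a b f \<in> Hom (slice_category (Gra U) G) (gr a, col a) (gr b, col b)"
    if ab: "a \<in> Obj C" "b \<in> Obj C" "f \<in> Hom C a b" for a b f
  proof -
    have "col a = compose (verts (gr a)) (col b) (Fm a b f)"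
    proof (rule extensionalityI[of _ "e a ` V a"])
      fix y assume "y \<in> e a ` V a"
      then obtain v where v: "v \<in> V a" "y = e a v" by blast
      show "col a y = compose (verts (gr a)) (col b) (Fm a b f) y"
        using v ab P(1,3)[OF ab v(1)] by (simp add: compose_def Fm_e col_e)
    qed (simp_all add: col_def)
    then show ?thesis using FmG[OF ab] by (simp add: slice_category_def Gra_def)
  qed
  have ext_eq: "F = F'" if "F \<in> extensional (e a ` V a)" "F' \<in> extensional (e a ` V a)"
    "\<And>v. v \<in> V a \<Longrightarrow> F (e a v) = F' (e a v)" for F F' :: "'u \<Rightarrow> 'u" and a
    by (rule extensionalityI[OF that(1,2)]) (use that(3) in auto)
  have "full_embedding C (slice_category (Gra U) G) (\<lambda>a. (gr a, col a)) Fm"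
    unfolding full_embedding_def
  proof (intro conjI ballI)
    show "is_functor C (slice_category (Gra U) G) (\<lambda>a. (gr a, col a)) Fm"
      unfolding is_functor_def
    proof (intro conjI ballI)
      show "(gr a, col a) \<in> Obj (slice_category (Gra U) G)" if "a \<in> Obj C" for a
        using that e(2) grG colG by (simp add: slice_category_def Gra_def)
      show "Fm a a (Ident C a) = Ident (slice_category (Gra U) G) (gr a, col a)" if a: "a \<in> Obj C" for a
        by (rule ext_eq[of _ a]) (use a P(4)[OF a] in \<open>auto simp: slice_category_def Gra_def Fm_e, simp_all add: Fm_def\<close>)
      show "Fm a d (Comp C a b d g f) = Comp (slice_category (Gra U) G) (gr a, col a) (gr b, col b) (gr d, col d) (Fm b d g) (Fm a b f)"
        if "a \<in> Obj C" "b \<in> Obj C" "d \<in> Obj C" "f \<in> Hom C a b" "g \<in> Hom C b d" for a b d f g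
      proof (rule ext_eq[of _ a])
        fix v assume v: "v \<in> V a"
        show "Fm a d (Comp C a b d g f) (e a v) =
            Comp (slice_category (Gra U) G) (gr a, col a) (gr b, col b) (gr d, col d) (Fm b d g) (Fm a b f) (e a v)"
          using that v P(1)[OF that(1,2,4) v] P(5)[OF that v]
          by (simp add: slice_category_def Gra_def compose_def Fm_e)
      qed (simp_all add: slice_category_def Gra_def, simp add: Fm_def)
    qed (use Fm_slice in blast)
    show "inj_on (\<lambda>a. (gr a, col a)) (Obj C)"
    proof (rule inj_onI)
      fix a b assume "a \<in> Obj C" "b \<in> Obj C" "(gr a, col a) = (gr b, col b)"
      moreover from this(3) have "verts (gr a) = verts (gr b)" by simp
      then have "e a ` V a = e b ` V b" unfolding gr_simps .
      ultimately show "a = b" using inj_onD[OF obj] by blast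
    qed
    fix a b assume ab: "a \<in> Obj C" "b \<in> Obj C"
    show "inj_on (Fm a b) (Hom C a b)"
    proof (rule inj_onI)
      fix f g assume fg: "f \<in> Hom C a b" "g \<in> Hom C a b" "Fm a b f = Fm a b g"
      show "f = g"
      proof (rule faithful[OF ab fg(1,2)])
        fix v assume v: "v \<in> V a"
        have "e b (P a b f v) = e b (P a b g v)" using Fm_e[OF ab(1) v] fg(3) by metis
        then show "P a b f v = P a b g v"
          using inj_onD[OF e(1)[OF ab(2)]] P(1)[OF ab _ v] fg by blast
      qed
    qed
    show "Fm a b ` Hom C a b = Hom (slice_category (Gra U) G) (gr a, col a) (gr b, col b)"
    proof (intro equalityI subsetI)
      show "y \<in> Hom (slice_category (Gra U) G) (gr a, col a) (gr b, col b)" if "y \<in> Fm a b ` Hom C a b" for y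
        using that Fm_slice ab by blast
      fix \<theta> assume "\<theta> \<in> Hom (slice_category (Gra U) G) (gr a, col a) (gr b, col b)"
      then have \<theta>: "\<theta> \<in> graph_hom (gr a) (gr b)" and \<theta>c: "col a = compose (verts (gr a)) (col b) \<theta>"
        by (simp_all add: slice_category_def Gra_def)
      have \<theta>V: "\<theta> (e a v) \<in> e b ` V b" if "v \<in> V a" for v
        using \<theta> that by (auto simp: graph_hom_def)
      \<comment> \<open>Decoding turns \<theta> into a colour-preserving map from \<open>V a\<close>
        to \<open>V b\<close>, to which \<open>full\<close> applies.\<close>
      have "\<exists>f\<in>Hom C a b. \<forall>v\<in>V a. dec b (\<theta> (e a v)) = P a b f v"
      proof (rule full[OF ab])
        show "dec b (\<theta> (e a v)) \<in> V b" if "v \<in> V a" for v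
          using decV(1)[OF \<theta>V[OF that]] .
        show "c (dec b (\<theta> (e a v))) = c v" if v: "v \<in> V a" for v
        proof -
          have "c v = col b (\<theta> (e a v))"
            using fun_cong[OF \<theta>c, of "e a v"] v by (simp add: col_e[OF ab(1) v] compose_def)
          also have "\<dots> = c (dec b (\<theta> (e a v)))" using \<theta>V[OF v] by (simp add: col_def)
          finally show ?thesis by simp
        qed
        show "{dec b (\<theta> (e a x)), dec b (\<theta> (e a y))} \<in> E b" if xy: "{x, y} \<in> E a" for x y
        proof -
          have "{e a x, e a y} \<in> edges (gr a)" using imageI[OF xy, of "\<lambda>d. e a ` d"] by simp
          then have "{\<theta> (e a x), \<theta> (e a y)} \<in> edges (gr b)" using \<theta> unfolding graph_hom_def by blast
          from edge[OF ab(2) this] show ?thesis using dec[OF ab(2)] by auto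
        qed
      qed
      then obtain f where f: "f \<in> Hom C a b" "\<And>v. v \<in> V a \<Longrightarrow> dec b (\<theta> (e a v)) = P a b f v" by blast
      have "\<theta> = Fm a b f"
      proof (rule ext_eq[of _ a])
        show "\<theta> (e a v) = Fm a b f (e a v)" if v: "v \<in> V a" for v
          using Fm_e[OF ab(1) v] f(2)[OF v] decV(2)[OF \<theta>V[OF v]] by simp
      qed (use \<theta> in \<open>auto simp: graph_hom_def PiE_iff Fm_def\<close>)
      then show "\<theta> \<in> Fm a b ` Hom C a b" using f(1) by blast
    qed
  qed
  then show ?thesis unfolding fully_embeds_def by blast
qed

lemma Alg_fully_embeds_slice_Gra:
  fixes U :: "'u set set" and G :: "'u graph"
  assumes U: "set_universe U" and \<Delta>: "type_in_universe U \<Delta>" and G: "is_graph G"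
    and w: "rigid_word k w" and wG: "\<And>i. i < k \<Longrightarrow> {w i, w (Suc i)} \<in> edges G"
  shows "fully_embeds (Alg U \<Delta>) (slice_category (Gra U) G)"
proof -
  \<comment> \<open>\<open>M X\<close> contains the vertices for all algebras on \<open>X\<close>,
    so the encoding can be chosen by the carrier alone.\<close>
  define M where "M X = pverts k (nodes \<Delta> X) (nodes \<Delta> X \<times> nodes \<Delta> X)" for X
  obtain j :: "'u \<Rightarrow> 'u" where j: "\<And>(M :: 'u node pvert set) \<iota> X. \<lbrakk>small U M; inj_on \<iota> X; \<iota> ` X \<subseteq> M\<rbrakk> \<Longrightarrow>
       \<exists>e. inj_on e M \<and> e ` M \<in> U \<and> (\<forall>x\<in>X. e (\<iota> x) = j x) \<and> {y. j y \<in> e ` M} = X"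
    using encoding_exists[OF U] by metis
  note k = rigid_wordD(1)[OF w]
  have arcsN: "arcs \<Delta> A \<subseteq> nodes \<Delta> (carrier A) \<times> nodes \<Delta> (carrier A)" for A by (auto simp: arcs_def)
  have "\<exists>e. inj_on e (M X) \<and> e ` M X \<in> U \<and> (\<forall>x\<in>X. e (Base (NX x)) = j x) \<and> {y. j y \<in> e ` M X} = X"
    if X: "X \<in> U" for X
  proof (rule j)
    show "small U (M X)" unfolding M_def using small_pverts[OF U small_nodes[OF U \<Delta> X]] .
    show "inj_on (\<lambda>x. Base (NX x)) X" by (simp add: inj_on_def)
    show "(\<lambda>x. Base (NX x)) ` X \<subseteq> M X" by (auto simp: M_def pverts_def)
  qed
  then obtain enc where enc: "\<And>X. X \<in> U \<Longrightarrow> inj_on (enc X) (M X)" "\<And>X. X \<in> U \<Longrightarrow> enc X ` M X \<in> U"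
    "\<And>X x. X \<in> U \<Longrightarrow> x \<in> X \<Longrightarrow> enc X (Base (NX x)) = j x"
    "\<And>X. X \<in> U \<Longrightarrow> {y. j y \<in> enc X ` M X} = X" by metis
  define V where "V A = pverts k (nodes \<Delta> (carrier A)) (arcs \<Delta> A)" for A
  have VM: "V A \<subseteq> M (carrier A)" for A
    using arcsN[of A] by (auto simp: V_def M_def pverts_def)
  have NXV: "Base (NX x) \<in> V A" if "x \<in> carrier A" for x A
    using that by (simp add: V_def pverts_def)
  have wi: "w i \<in> verts G" if "i < k" for i
    using wG[OF that] G by (auto simp: is_graph_def)
  have Alg: "A \<in> Obj (Alg U \<Delta>) \<longleftrightarrow> carrier A \<in> U \<and> is_algebra \<Delta> A" "Hom (Alg U \<Delta>) = algebra_hom \<Delta>"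
    "Ident (Alg U \<Delta>) A = (\<lambda>x\<in>carrier A. x)" "Comp (Alg U \<Delta>) A B C g f = compose (carrier A) g f"
    for A B C f g
    by (simp_all add: Alg_def)
  have lift: "lift \<Delta> h v \<in> nodes \<Delta> (carrier B)" if "h \<in> algebra_hom \<Delta> A B" "v \<in> nodes \<Delta> (carrier A)" for h A B v
    by (rule lift_node[OF _ that(2)]) (use that(1) in \<open>auto simp: algebra_hom_def\<close>)
  have V_cases: "(\<exists>a. v = Base a \<and> a \<in> nodes \<Delta> (carrier A)) \<or>
      (\<exists>a b i. v = Inner a b i \<and> a \<in> nodes \<Delta> (carrier A) \<and> b \<in> nodes \<Delta> (carrier A))" if "v \<in> V A" for v A
    using that arcsN[of A] by (auto simp: V_def pverts_def)
  show ?thesis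
  proof (rule fully_embeds_slice_Gra[where V = V and E = "\<lambda>A. pedges k (arcs \<Delta> A)" and c = "pcol w"
        and e = "\<lambda>A. enc (carrier A)" and P = "\<lambda>A B h. map_pvert (lift \<Delta> h)", OF is_category_Alg[of U \<Delta>], unfolded Alg])
    show "inj_on (enc (carrier A)) (V A)" if "carrier A \<in> U \<and> is_algebra \<Delta> A" for A
      using inj_on_subset[OF enc(1) VM] that by blast
    show "enc (carrier A) ` V A \<in> U" if "carrier A \<in> U \<and> is_algebra \<Delta> A" for A
    proof -
      have "enc (carrier A) ` V A \<lesssim> enc (carrier A) ` M (carrier A)"
        by (rule subset_imp_lepoll) (rule image_mono[OF VM])
      then show ?thesis using U enc(2) that unfolding set_universe_def by blast
    qed
    show "inj_on (\<lambda>A. enc (carrier A) ` V A) (Obj (Alg U \<Delta>))"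
    proof (rule inj_onI)
      \<comment> \<open>The encoded vertex set determines the carrier, hence the encoding, hence the
        vertex set itself.\<close>
      have car: "{y. j y \<in> enc (carrier A) ` V A} = carrier A" if A: "carrier A \<in> U" for A
      proof
        show "{y. j y \<in> enc (carrier A) ` V A} \<subseteq> carrier A" using enc(4)[OF A] VM[of A] by blast
        show "carrier A \<subseteq> {y. j y \<in> enc (carrier A) ` V A}"
        proof
          fix x assume "x \<in> carrier A"
          then show "x \<in> {y. j y \<in> enc (carrier A) ` V A}"
            using imageI[OF NXV, of x A "enc (carrier A)"] enc(3)[OF A] by simp
        qed
      qed
      fix A B assume "A \<in> Obj (Alg U \<Delta>)" "B \<in> Obj (Alg U \<Delta>)"
        and eq: "enc (carrier A) ` V A = enc (carrier B) ` V B"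
      then have A: "carrier A \<in> U" "is_algebra \<Delta> A" and B: "carrier B \<in> U" "is_algebra \<Delta> B"
        by (simp_all add: Alg)
      have cc: "carrier A = carrier B" using car[OF A(1)] car[OF B(1)] eq by simp
      then have "V A = V B"
        using eq inj_on_image_eq_iff[OF enc(1)[OF A(1)], of "V A" "V B"] VM[of A] VM[of B] by simp
      \<comment> \<open>Since \<open>k \<ge> 2\<close>, every arc has an inner vertex with index 1,
        so the vertex set reveals the arcs.\<close>
      moreover have "(a, b) \<in> arcs \<Delta> A \<longleftrightarrow> Inner a b 1 \<in> V A" for a b A
        using k by (auto simp: V_def pverts_def)
      ultimately have "arcs \<Delta> A = arcs \<Delta> B" by auto
      then show "A = B" using arcs_determine_algebra A B cc by blast
    qed
    show "d \<subseteq> V A" if "d \<in> pedges k (arcs \<Delta> A)" for A d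
      unfolding V_def by (rule pedges_subset[OF arcsN that])
    show "card d = 2" if "d \<in> pedges k (arcs \<Delta> A)" for A d
      by (rule card_pedge[OF k that])
    show "pcol w v \<in> verts G" if "v \<in> V A" for A v
      using that wi k by (auto simp: V_def pverts_def)
    show "{pcol w x, pcol w y} \<in> edges G" if xy: "{x, y} \<in> pedges k (arcs \<Delta> A)" for A x y
    proof -
      obtain a b i where "i < k" and e: "{x, y} = {path_vert k a b i, path_vert k a b (Suc i)}"
        using xy unfolding pedges_def by blast
      have "{pcol w x, pcol w y} = {w i, w (Suc i)}"
        using arg_cong[OF e, of "\<lambda>d. pcol w ` d"] by (simp add: pcol_path_vert[of w, OF rigid_wordD(2)[OF w]])
      then show ?thesis using wG[OF \<open>i < k\<close>] by simp
    qed
    fix A B and h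
    assume A: "carrier A \<in> U \<and> is_algebra \<Delta> A" and B: "carrier B \<in> U \<and> is_algebra \<Delta> B"
    show "map_pvert (lift \<Delta> h) v \<in> V B" if "h \<in> algebra_hom \<Delta> A B" "v \<in> V A" for h v
      unfolding V_def by (rule pverts_map[OF lift lift_arc]) (use that in \<open>auto simp: V_def\<close>)
    show "{map_pvert (lift \<Delta> h) x, map_pvert (lift \<Delta> h) y} \<in> pedges k (arcs \<Delta> B)"
      if "h \<in> algebra_hom \<Delta> A B" "{x, y} \<in> pedges k (arcs \<Delta> A)" for h x y
      using pedges_map[OF lift_arc[OF that(1)] that(2)] by simp
    show "pcol w (map_pvert (lift \<Delta> h) v) = pcol w v" for h v
      by (rule pcol_map_pvert)
    show "map_pvert (lift \<Delta> (\<lambda>x\<in>carrier A. x)) v = v" if "v \<in> V A" for v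
      using V_cases[OF that] lift_id by auto
    show "map_pvert (lift \<Delta> (compose (carrier A) g f)) v = map_pvert (lift \<Delta> g) (map_pvert (lift \<Delta> f) v)"
      if "v \<in> V A" for f g v
      using V_cases[OF that] lift_compose by auto
    show "f = g" if fg: "f \<in> algebra_hom \<Delta> A B" "g \<in> algebra_hom \<Delta> A B"
      and eq: "\<And>v. v \<in> V A \<Longrightarrow> map_pvert (lift \<Delta> f) v = map_pvert (lift \<Delta> g) v" for f g
    proof (rule PiE_ext)
      show "f \<in> carrier A \<rightarrow>\<^sub>E carrier B" "g \<in> carrier A \<rightarrow>\<^sub>E carrier B"
        using fg by (simp_all add: algebra_hom_def)
      show "f x = g x" if "x \<in> carrier A" for x using eq[OF NXV[OF that]] by simp
    qed
    show "\<exists>h\<in>algebra_hom \<Delta> A B. \<forall>v\<in>V A. \<psi> v = map_pvert (lift \<Delta> h) v"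
      if \<psi>: "\<And>v. v \<in> V A \<Longrightarrow> \<psi> v \<in> V B"
        "\<And>x y. {x, y} \<in> pedges k (arcs \<Delta> A) \<Longrightarrow> {\<psi> x, \<psi> y} \<in> pedges k (arcs \<Delta> B)"
        "\<And>v. v \<in> V A \<Longrightarrow> pcol w (\<psi> v) = pcol w v" for \<psi>
    proof -
      obtain \<phi> where \<phi>: "\<And>a. a \<in> nodes \<Delta> (carrier A) \<Longrightarrow> \<phi> a \<in> nodes \<Delta> (carrier B)"
        "\<And>a b. (a, b) \<in> arcs \<Delta> A \<Longrightarrow> (\<phi> a, \<phi> b) \<in> arcs \<Delta> B"
        "\<And>v. v \<in> V A \<Longrightarrow> \<psi> v = map_pvert \<phi> v"
        by (rule pcol_hom_is_map_pvert[where \<psi> = \<psi>, OF w arcsN[of A] arcsN[of B] \<psi>[unfolded V_def]])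
          (assumption | rule that, unfold V_def)+
      obtain h where h: "h \<in> algebra_hom \<Delta> A B" "\<And>v. v \<in> nodes \<Delta> (carrier A) \<Longrightarrow> \<phi> v = lift \<Delta> h v"
        using arc_hom_is_lift[where \<phi> = \<phi> and A = A and B = B and \<Delta> = \<Delta>] A \<phi>(1,2) by metis
      have "\<psi> v = map_pvert (lift \<Delta> h) v" if "v \<in> V A" for v
        using V_cases[OF that] \<phi>(3)[OF that] h(2) by auto
      then show ?thesis using h(1) by blast
    qed
  qed
qed

text \<open>A full subcategory keeps its hom-sets, so the isomorphism followed by the embedding
  stays full; the inverse functor supplies preimages of morphisms and injectivity.\<close>

lemma fully_embeds_isomorphic_full_subcategory:
  assumes K: "isomorphic_categories K (full_subcategory C S)" and C: "fully_embeds C D"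
  shows "fully_embeds K D"
proof -
  obtain Ho Hm where H: "full_embedding C D Ho Hm" using C by (auto simp: fully_embeds_def)
  obtain Fo Fm Go Gm where F: "is_functor K (full_subcategory C S) Fo Fm"
    and G: "is_functor (full_subcategory C S) K Go Gm"
    and GF: "\<And>a. a \<in> Obj K \<Longrightarrow> Go (Fo a) = a"
    and GFm: "\<And>a b f. \<lbrakk>a \<in> Obj K; b \<in> Obj K; f \<in> Hom K a b\<rbrakk> \<Longrightarrow> Gm (Fo a) (Fo b) (Fm a b f) = f"
    and FGm: "\<And>x y g. \<lbrakk>x \<in> Obj (full_subcategory C S); y \<in> Obj (full_subcategory C S); g \<in> Hom (full_subcategory C S) x y\<rbrakk>
        \<Longrightarrow> Fm (Go x) (Go y) (Gm x y g) = g"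
    using K unfolding isomorphic_categories_def by blast
  have sub: "Obj (full_subcategory C S) = Obj C \<inter> S" "Hom (full_subcategory C S) = Hom C"
    "Ident (full_subcategory C S) = Ident C" "Comp (full_subcategory C S) = Comp C"
    by (simp_all add: full_subcategory_def)
  have Fo: "Fo a \<in> Obj C" "Fo a \<in> S" if "a \<in> Obj K" for a
    using F that by (auto simp: is_functor_def sub)
  have bij: "Fm a b ` Hom K a b = Hom C (Fo a) (Fo b)" if ab: "a \<in> Obj K" "b \<in> Obj K" for a b
  proof
    show "Fm a b ` Hom K a b \<subseteq> Hom C (Fo a) (Fo b)" using F ab by (auto simp: is_functor_def sub)
    show "Hom C (Fo a) (Fo b) \<subseteq> Fm a b ` Hom K a b"
    proof
      fix g assume g: "g \<in> Hom C (Fo a) (Fo b)"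
      then have "Gm (Fo a) (Fo b) g \<in> Hom K a b"
        using G Fo ab GF by (auto simp: is_functor_def sub) (metis IntI)
      moreover have "g = Fm a b (Gm (Fo a) (Fo b) g)"
        using FGm[of "Fo a" "Fo b" g] g Fo ab GF by (simp add: sub)
      ultimately show "g \<in> Fm a b ` Hom K a b" by blast
    qed
  qed
  have inj: "inj_on (Fm a b) (Hom K a b)" if "a \<in> Obj K" "b \<in> Obj K" for a b
    using GFm that by (metis inj_onI)
  have Fhom: "Fm a b f \<in> Hom C (Fo a) (Fo b)" if "a \<in> Obj K" "b \<in> Obj K" "f \<in> Hom K a b" for a b f
    using bij that by blast
  have "full_embedding K D (\<lambda>a. Ho (Fo a)) (\<lambda>a b f. Hm (Fo a) (Fo b) (Fm a b f))"
    unfolding full_embedding_def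
  proof (intro conjI ballI)
    show "is_functor K D (\<lambda>a. Ho (Fo a)) (\<lambda>a b f. Hm (Fo a) (Fo b) (Fm a b f))"
      using F H Fo Fhom unfolding is_functor_def full_embedding_def sub by simp
    show "inj_on (\<lambda>a. Ho (Fo a)) (Obj K)"
      using H Fo GF unfolding full_embedding_def inj_on_def by metis
    fix a b assume ab: "a \<in> Obj K" "b \<in> Obj K"
    have "inj_on (Hm (Fo a) (Fo b)) (Hom C (Fo a) (Fo b))"
      and img: "Hm (Fo a) (Fo b) ` Hom C (Fo a) (Fo b) = Hom D (Ho (Fo a)) (Ho (Fo b))"
      using H Fo ab by (auto simp: full_embedding_def)
    then show "inj_on (\<lambda>f. Hm (Fo a) (Fo b) (Fm a b f)) (Hom K a b)"
      using comp_inj_on[OF inj[OF ab], of "Hm (Fo a) (Fo b)"] bij[OF ab] by (simp add: comp_def)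
    show "(\<lambda>f. Hm (Fo a) (Fo b) (Fm a b f)) ` Hom K a b = Hom D (Ho (Fo a)) (Ho (Fo b))"
      using img bij[OF ab] by (metis image_image)
  qed
  then show ?thesis by (auto simp: fully_embeds_def)
qed

theorem theorem4p10:
  fixes U :: "'u set set" and G :: "'u graph"
  assumes "set_universe U"
    and "G \<in> Obj (Gra U)"
    and "contains_subgraph G (cycle_graph 3) \<or> contains_subgraph G (cycle_graph 4) \<or>
         contains_subgraph G (path_graph 4) \<or> contains_subgraph G Y_graph"
  shows "algebraically_universal U TYPE('x) TYPE('y) (slice_category (Gra U) G)"
proof -
  have G: "is_graph G" using assms(2) by (simp add: Gra_def)
  obtain k w where w: "rigid_word k w" "\<And>i. i < k \<Longrightarrow> {w i, w (Suc i)} \<in> edges G"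
    using exists_rigid_closed_walk[OF G assms(3)] by blast
  show ?thesis
    unfolding algebraically_universal_def algebraic_def
    using fully_embeds_isomorphic_full_subcategory Alg_fully_embeds_slice_Gra[OF assms(1) _ G w] by blast
qed

end
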